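(* Let $k\in\mathbb{N}_{\ge 1}$, $h\in\mathbb{N}$, and let $X=X_1\times\cdots\times X_k$, $Y=Y_1\times\cdots\times Y_h$, $Z=Z_1\times\cdots\times Z_k$ be products of Polish spaces. Given a Borel transportation cost $c:Z\times Y\to[0,+\infty]$, Borel maps $l_i:X_i\to Z_i$ ($i=1,\dots,k$), $l:=l_1\times\cdots\times l_k$, and probability measures $\mu_i\in\mathcal{P}(X_i)$ ($i=1,\dots,k$), $\mu:=(\mu_1,\dots,\mu_k)$, it holds that $$\mathcal{J}[c\circ(l\times\mathrm{id}_Y)](\mu)=\inf_{\substack{\boldsymbol{\mu}\in\mathcal{P}(X\times Y)\\(\mathrm{proj}_X)_\#\boldsymbol{\mu}\in\Gamma(\mu)}}\int_{X\times Y}c\circ(l\times\mathrm{id}_Y)\,d\boldsymbol{\mu}=\inf_{\substack{\boldsymbol{\mu}'\in\mathcal{P}(Z\times Y)\\(\mathrm{proj}_Z)_\#\boldsymbol{\mu}'\in\Gamma(l_\#\mu)}}\int_{Z\times Y}c\,d\boldsymbol{\mu}'=\mathcal{J}[c](l_\#\mu).$$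
   Context: All spaces are Polish, all probability measures and maps are Borel. $\mathcal{P}(S)$ is the set of Borel probability measures on $S$; $T_\#\mu$ denotes pushforward. $\Gamma(\mu_1,\dots,\mu_k)$ is the set of $\gamma\in\mathcal{P}(X_1\times\cdots\times X_k)$ with $i$-th marginal $\mu_i$ for all $i$. The map $l=l_1\times\cdots\times l_k:X\to Z$ is $(x_1,\dots,x_k)\mapsto(l_1(x_1),\dots,l_k(x_k))$, and $l_\#\mu:=((l_1)_\#\mu_1,\dots,(l_k)_\#\mu_k)$ (a tuple of measures). $(l\times\mathrm{id}_Y)(x,y)=(l(x),y)$. Optimal transport with free marginals: for $\tilde c:X\times Y\to[0,+\infty]$, $$\mathcal{J}[\tilde c](\mu_1,\dots,\mu_k):=\inf\left\{\int_{X\times Y}\tilde c\,d\gamma\ :\ \gamma\in\mathcal{P}(X\times Y),\ (\mathrm{proj}_X)_\#\gamma\in\Gamma(\mu_1,\dots,\mu_k)\right\},$$ i.e. only the marginals on $X_1,\dots,X_k$ are fixed; and analogously on $Z\times Y$. When $h=0$ there is no factor $Y$ (no free marginals) and $\mathcal{J}$ is the multi-marginal optimal transport value $\mathcal{K}[\tilde c](\mu_1,\dots,\mu_k)=\inf_{\gamma\in\Gamma(\mu_1,\dots,\mu_k)}\int\tilde c\,d\gamma$. *)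

theory Defs
  imports "HOL-Probability.Probability"
begin

(* Spaces are abstract topologies, each with its own carrier, so that the factors of a product
   may be different Polish spaces although they share an ambient type. *)
definition Polish_space :: "'a topology \<Rightarrow> bool" where
  "Polish_space T \<longleftrightarrow> completely_metrizable_space T \<and> separable_space T"

definition borel_of :: "'a topology \<Rightarrow> 'a measure" where
  "borel_of T = sigma (topspace T) {U. openin T U}"

definition prob_measures :: "'a topology \<Rightarrow> 'a measure set" where
  "prob_measures T = {M. sets M = sets (borel_of T) \<and> prob_space M}"

abbreviation prod_space :: "(nat \<Rightarrow> 'a topology) \<Rightarrow> nat \<Rightarrow> (nat \<Rightarrow> 'a) topology" where
  "prod_space X n \<equiv> product_topology X {1..n}"

definition couplings ::
    "(nat \<Rightarrow> 'a topology) \<Rightarrow> nat \<Rightarrow> (nat \<Rightarrow> 'a measure) \<Rightarrow> (nat \<Rightarrow> 'a) measure set" where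
  "couplings X k \<mu> =
    {\<gamma> \<in> prob_measures (prod_space X k). \<forall>i\<in>{1..k}. distr \<gamma> (borel_of (X i)) (\<lambda>x. x i) = \<mu> i}"

definition free_couplings ::
    "(nat \<Rightarrow> 'a topology) \<Rightarrow> nat \<Rightarrow> (nat \<Rightarrow> 'b topology) \<Rightarrow> nat \<Rightarrow> (nat \<Rightarrow> 'a measure)
      \<Rightarrow> ((nat \<Rightarrow> 'a) \<times> (nat \<Rightarrow> 'b)) measure set" where
  "free_couplings X k Y h \<mu> =
    {\<gamma> \<in> prob_measures (prod_topology (prod_space X k) (prod_space Y h)).
       distr \<gamma> (borel_of (prod_space X k)) fst \<in> couplings X k \<mu>}"

definition OT_free ::
    "(nat \<Rightarrow> 'a topology) \<Rightarrow> nat \<Rightarrow> (nat \<Rightarrow> 'b topology) \<Rightarrow> nat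
      \<Rightarrow> ((nat \<Rightarrow> 'a) \<times> (nat \<Rightarrow> 'b) \<Rightarrow> ennreal) \<Rightarrow> (nat \<Rightarrow> 'a measure) \<Rightarrow> ennreal" where
  "OT_free X k Y h c \<mu> = (INF \<gamma>\<in>free_couplings X k Y h \<mu>. \<integral>\<^sup>+ p. c p \<partial>\<gamma>)"

definition OT_multi ::
    "(nat \<Rightarrow> 'a topology) \<Rightarrow> nat \<Rightarrow> ((nat \<Rightarrow> 'a) \<Rightarrow> ennreal) \<Rightarrow> (nat \<Rightarrow> 'a measure) \<Rightarrow> ennreal" where
  "OT_multi X k c \<mu> = (INF \<gamma>\<in>couplings X k \<mu>. \<integral>\<^sup>+ x. c x \<partial>\<gamma>)"

definition map_tuple :: "nat \<Rightarrow> (nat \<Rightarrow> 'a \<Rightarrow> 'b) \<Rightarrow> (nat \<Rightarrow> 'a) \<Rightarrow> (nat \<Rightarrow> 'b)" where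
  "map_tuple k l x = (\<lambda>i\<in>{1..k}. l i (x i))"

definition push_tuple ::
    "(nat \<Rightarrow> 'b topology) \<Rightarrow> (nat \<Rightarrow> 'a \<Rightarrow> 'b) \<Rightarrow> (nat \<Rightarrow> 'a measure) \<Rightarrow> (nat \<Rightarrow> 'b measure)" where
  "push_tuple Z l \<mu> = (\<lambda>i. distr (\<mu> i) (borel_of (Z i)) (l i))"

lemma space_borel_of: "space (borel_of T) = topspace T"
  unfolding borel_of_def by (rule space_measure_of) (auto dest: openin_subset)

lemma sets_borel_of: "sets (borel_of T) = sigma_sets (topspace T) {U. openin T U}"
  unfolding borel_of_def by (rule sets_measure_of) (auto dest: openin_subset)

lemma continuous_map_measurable_borel_of:
  assumes "continuous_map S T f"
  shows "f \<in> borel_of S \<rightarrow>\<^sub>M borel_of T"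
proof (rule measurable_sigma_sets[OF sets_borel_of])
  show "{U. openin T U} \<subseteq> Pow (topspace T)"
    by (auto dest: openin_subset)
  show "f \<in> space (borel_of S) \<rightarrow> topspace T"
    using assms by (auto simp: space_borel_of continuous_map_def)
  fix U assume "U \<in> {U. openin T U}"
  then have "openin S {x \<in> topspace S. f x \<in> U}"
    using assms by (auto simp: continuous_map_def)
  moreover have "f -` U \<inter> space (borel_of S) = {x \<in> topspace S. f x \<in> U}"
    by (auto simp: space_borel_of)
  ultimately show "f -` U \<inter> space (borel_of S) \<in> sets (borel_of S)"
    by (auto simp: sets_borel_of)
qed

(* For h = 0 the factor Y is the one-point space containing only the empty tuple, and the
   problem with free marginals is the ordinary multi-marginal one. *)
lemma OT_free_0:
  assumes c: "c \<in> borel_measurable (borel_of (prod_topology (prod_space X k) (prod_space Y 0)))"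
  shows "OT_free X k Y 0 c \<mu> = OT_multi X k (\<lambda>x. c (x, \<lambda>_. undefined)) \<mu>"
proof -
  let ?P = "prod_space X k" and ?u = "(\<lambda>_. undefined) :: nat \<Rightarrow> 'b"
  let ?Q = "prod_topology ?P (prod_space Y 0)"
  let ?e = "\<lambda>x. (x, ?u)"
  have e: "?e \<in> borel_of ?P \<rightarrow>\<^sub>M borel_of ?Q"
    by (rule continuous_map_measurable_borel_of) (auto simp: continuous_map_pairedI)
  have f: "fst \<in> borel_of ?Q \<rightarrow>\<^sub>M borel_of ?P"
    by (rule continuous_map_measurable_borel_of) (rule continuous_map_fst)
  show ?thesis unfolding OT_free_def OT_multi_def
  proof (rule INF_eq)
    fix \<gamma> assume g: "\<gamma> \<in> free_couplings X k Y 0 \<mu>"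
    then have s: "sets \<gamma> = sets (borel_of ?Q)"
      by (auto simp: free_couplings_def prob_measures_def)
    have sp: "space \<gamma> = topspace ?P \<times> {?u}"
      using sets_eq_imp_space_eq[OF s] by (simp add: space_borel_of)
    have f': "fst \<in> \<gamma> \<rightarrow>\<^sub>M borel_of ?P"
      using f measurable_cong_sets[OF s refl] by blast
    have "(\<integral>\<^sup>+ x. c (?e x) \<partial>distr \<gamma> (borel_of ?P) fst) = (\<integral>\<^sup>+ p. c (?e (fst p)) \<partial>\<gamma>)"
      by (rule nn_integral_distr[OF f']) (use measurable_compose[OF e c] in simp)
    also have "\<dots> = (\<integral>\<^sup>+ p. c p \<partial>\<gamma>)"
      by (rule nn_integral_cong) (auto simp: sp)
    finally show "\<exists>x\<in>couplings X k \<mu>. (\<integral>\<^sup>+ x. c (?e x) \<partial>x) \<le> (\<integral>\<^sup>+ p. c p \<partial>\<gamma>)"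
      using g by (auto simp: free_couplings_def intro!: bexI)
  next
    fix \<gamma> assume g: "\<gamma> \<in> couplings X k \<mu>"
    then have s: "sets \<gamma> = sets (borel_of ?P)" and p: "prob_space \<gamma>"
      by (auto simp: couplings_def prob_measures_def)
    have e': "?e \<in> \<gamma> \<rightarrow>\<^sub>M borel_of ?Q"
      using e measurable_cong_sets[OF s refl] by blast
    have "distr (distr \<gamma> (borel_of ?Q) ?e) (borel_of ?P) fst = \<gamma>"
      unfolding distr_distr[OF f e'] using distr_id2[OF s[symmetric]] by (simp add: comp_def)
    then have "distr \<gamma> (borel_of ?Q) ?e \<in> free_couplings X k Y 0 \<mu>"
      using g prob_space.prob_space_distr[OF p e']
      by (simp add: free_couplings_def prob_measures_def)
    moreover have "(\<integral>\<^sup>+ p. c p \<partial>distr \<gamma> (borel_of ?Q) ?e) = (\<integral>\<^sup>+ x. c (?e x) \<partial>\<gamma>)"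
      by (rule nn_integral_distr[OF e']) (use c in simp)
    ultimately show "\<exists>x\<in>free_couplings X k Y 0 \<mu>. (\<integral>\<^sup>+ p. c p \<partial>x) \<le> (\<integral>\<^sup>+ x. c (?e x) \<partial>\<gamma>)"
      by (auto intro!: bexI)
  qed
qed

end

theory Submission
  imports Defs
begin

text \<open>
  Pushing a plan on \<open>X \<times> Y\<close> forward along \<open>l \<times> id\<close> gives a plan on \<open>Z \<times> Y\<close> of the same cost, so it
  suffices that every admissible plan \<open>\<gamma>'\<close> on \<open>Z \<times> Y\<close> arises in this way. Disintegrating \<open>\<mu>\<^sub>i\<close> along
  \<open>l\<^sub>i\<close> and sampling from the conditional laws with a uniform seed \<open>u\<close> yields a Borel map \<open>T\<^sub>i(z, u)\<close> such
  that \<open>T\<^sub>i\<close> pushes \<open>(l\<^sub>i)\<^sub># \<mu>\<^sub>i \<otimes> U\<close> to \<open>\<mu>\<^sub>i\<close> and \<open>l\<^sub>i (T\<^sub>i (z, u)) = z\<close> almost surely. The law of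
  \<open>((T\<^sub>1(z\<^sub>1, u), \<dots>, T\<^sub>k(z\<^sub>k, u)), y)\<close> under \<open>\<gamma>' \<otimes> U\<close> is the required lift; only the individual marginals
  are prescribed, so one seed \<open>u\<close> can serve all \<open>i\<close>. The maps \<open>T\<^sub>i\<close> are quantile functions of
  conditional distributions, after \<open>X\<^sub>i\<close> has been encoded Borel measurably by real numbers.
\<close>

section \<open>Borel measurability into products of second countable spaces\<close>

text \<open>Take \<open>1 / real (Suc n)\<close> below half the radius of a ball around
  \<open>x\<close> inside \<open>U\<close>, and a centre in \<open>D\<close> that close to
  \<open>x\<close>; the triangle inequality does the rest. For countable \<open>D\<close> these
  balls form a countable base, used both for second countability and for the measurability of the
  decoder below.\<close>

lemma (in Metric_space) dense_ball_base:
  assumes "D \<subseteq> M" and "mtopology closure_of D = M" and "openin mtopology U" and "x \<in> U"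
  obtains y n where "y \<in> D" and "x \<in> mball y (1 / real (Suc n))"
    and "mball y (1 / real (Suc n)) \<subseteq> U"
proof -
  obtain r where r: "r > 0" "mball x r \<subseteq> U" and x: "x \<in> M"
    using assms(3,4) unfolding openin_mtopology by blast
  obtain n where n: "1 / real (Suc n) < r / 2"
    using r by (metis half_gt_zero nat_approx_posE)
  have "\<forall>r>0. \<exists>y\<in>D. y \<in> mball x r"
    using x assms(2) unfolding metric_closure_of by blast
  then obtain y where y: "y \<in> D" "y \<in> mball x (1 / real (Suc n))"
    by (meson of_nat_0_less_iff zero_less_Suc zero_less_divide_1_iff)
  have "mball y (1 / real (Suc n)) \<subseteq> mball x r"
  proof
    fix w assume "w \<in> mball y (1 / real (Suc n))"
    then show "w \<in> mball x r"
      using y n triangle[of x y w] by auto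
  qed
  moreover have "x \<in> mball y (1 / real (Suc n))"
    using y by (auto simp: commute)
  ultimately show ?thesis
    using that y(1) r(2) by blast
qed

lemma Polish_space_imp_second_countable:
  assumes "Polish_space T"
  shows "second_countable T"
proof -
  obtain M d where m: "Metric_space M d" and T: "T = Metric_space.mtopology M d"
    using assms by (auto simp: Polish_space_def completely_metrizable_space_def)
  interpret Metric_space M d by fact
  obtain D where D: "countable D" "D \<subseteq> M" and dense: "mtopology closure_of D = M"
    using assms by (auto simp: Polish_space_def separable_space_def T)
  show ?thesis
    unfolding second_countable_def
  proof (intro exI conjI allI impI ballI)
    let ?B = "(\<lambda>(y, n). mball y (1 / real (Suc n))) ` (D \<times> UNIV)"
    show "countable ?B" using D by simp
    show "openin T V" if "V \<in> ?B" for V using that by (auto simp: T)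
    fix W x assume W: "openin T W \<and> x \<in> W"
    then obtain y n where "y \<in> D" "x \<in> mball y (1 / real (Suc n))"
        "mball y (1 / real (Suc n)) \<subseteq> W"
      using dense_ball_base[OF D(2) dense] unfolding T by metis
    then show "\<exists>V\<in>?B. x \<in> V \<and> V \<subseteq> W"
      by (intro bexI[of _ "mball y (1 / real (Suc n))"]) auto
  qed
qed

section \<open>Measurability tested on countable bases\<close>

lemma openin_in_sets_borel_of: "openin T U \<Longrightarrow> U \<in> sets (borel_of T)"
  by (auto simp: sets_borel_of)

lemma measurable_borel_ofI:
  assumes "f \<in> space M \<rightarrow> topspace T"
    and "\<And>U. openin T U \<Longrightarrow> f -` U \<inter> space M \<in> sets M"
  shows "f \<in> M \<rightarrow>\<^sub>M borel_of T"
  by (rule measurable_sigma_sets[OF sets_borel_of]) (use assms in \<open>auto dest: openin_subset\<close>)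

text \<open>An open set is the union of the members of \<open>B\<close> inside it, and this union is
  countable, so its preimage is a countable union of measurable sets.\<close>

lemma measurable_borel_of_base:
  assumes f: "f \<in> space M \<rightarrow> topspace T"
    and B: "countable B"
    and base: "\<And>U x. openin T U \<Longrightarrow> x \<in> U \<Longrightarrow> \<exists>V\<in>B. x \<in> V \<and> V \<subseteq> U"
    and meas: "\<And>V. V \<in> B \<Longrightarrow> f -` V \<inter> space M \<in> sets M"
  shows "f \<in> M \<rightarrow>\<^sub>M borel_of T"
proof (rule measurable_borel_ofI[OF f])
  fix U assume U: "openin T U"
  have "f -` U \<inter> space M = (\<Union>V\<in>{V\<in>B. V \<subseteq> U}. f -` V \<inter> space M)"
  proof
    show "f -` U \<inter> space M \<subseteq> (\<Union>V\<in>{V\<in>B. V \<subseteq> U}. f -` V \<inter> space M)"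
    proof
      fix x assume x: "x \<in> f -` U \<inter> space M"
      then obtain V where "V \<in> B" "f x \<in> V" "V \<subseteq> U"
        using base[OF U, of "f x"] by auto
      with x show "x \<in> (\<Union>V\<in>{V\<in>B. V \<subseteq> U}. f -` V \<inter> space M)"
        by (intro UN_I[of V]) auto
    qed
  qed auto
  also have "\<dots> \<in> sets M"
    using B meas by (intro sets.countable_UN'') auto
  finally show "f -` U \<inter> space M \<in> sets M" .
qed

text \<open>Boxes with basic sides do it: finiteness of \<open>I\<close> makes
  \<open>PiE I b\<close> countable. The box form is recorded because preimages of boxes can be
  treated one coordinate at a time.\<close>

lemma second_countable_product_base:
  assumes fin: "finite I" and sc: "\<And>i. i \<in> I \<Longrightarrow> second_countable (X i)"
  shows "\<exists>B. countable B \<and> (\<forall>V\<in>B. \<exists>E. V = PiE I E \<and> (\<forall>i\<in>I. openin (X i) (E i)))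
    \<and> (\<forall>U x. openin (product_topology X I) U \<and> x \<in> U \<longrightarrow> (\<exists>V\<in>B. x \<in> V \<and> V \<subseteq> U))"
proof -
  from sc obtain b where b: "\<And>i. i \<in> I \<Longrightarrow> countable (b i)"
    "\<And>i V. i \<in> I \<Longrightarrow> V \<in> b i \<Longrightarrow> openin (X i) V"
    "\<And>i U x. i \<in> I \<Longrightarrow> openin (X i) U \<Longrightarrow> x \<in> U \<Longrightarrow> \<exists>V\<in>b i. x \<in> V \<and> V \<subseteq> U"
    unfolding second_countable_def by metis
  show ?thesis
  proof (intro exI[of _ "PiE I ` PiE I b"] conjI ballI allI impI)
    let ?B = "PiE I ` PiE I b"
    show "countable ?B" using fin b by (intro countable_image countable_PiE) auto
    show "\<exists>E. V = PiE I E \<and> (\<forall>i\<in>I. openin (X i) (E i))" if "V \<in> ?B" for V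
      using that b(2) by (auto simp: PiE_iff)
    fix U x assume "openin (product_topology X I) U \<and> x \<in> U"
    then obtain W where W: "x \<in> PiE I W" "\<And>i. openin (X i) (W i)" "PiE I W \<subseteq> U"
      using product_topology_open_contains_basis[of X I U x] by auto
    have "\<forall>i\<in>I. \<exists>V\<in>b i. x i \<in> V \<and> V \<subseteq> W i"
      using W b(3) by (auto simp: PiE_iff)
    then obtain E where E: "\<And>i. i \<in> I \<Longrightarrow> E i \<in> b i \<and> x i \<in> E i \<and> E i \<subseteq> W i"
      by metis
    \<comment> \<open>\<open>E\<close> is unconstrained outside \<open>I\<close>; restricting it
      makes it an element of \<open>PiE I b\<close>.\<close>
    have "PiE I (restrict E I) \<in> ?B" using E by auto
    moreover have "x \<in> PiE I (restrict E I)" using E W(1) by (auto simp: PiE_iff)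
    moreover have "PiE I (restrict E I) \<subseteq> PiE I W" using E by (intro PiE_mono) auto
    ultimately show "\<exists>V\<in>?B. x \<in> V \<and> V \<subseteq> U"
      using W(3) by (intro bexI[of _ "PiE I (restrict E I)"]) auto
  qed
qed

lemma second_countable_product_topology:
  assumes "finite I" and "\<And>i. i \<in> I \<Longrightarrow> second_countable (X i)"
  shows "second_countable (product_topology X I)"
proof -
  obtain B where B: "countable B"
    "\<forall>V\<in>B. \<exists>E. V = PiE I E \<and> (\<forall>i\<in>I. openin (X i) (E i))"
    "\<forall>U x. openin (product_topology X I) U \<and> x \<in> U \<longrightarrow> (\<exists>V\<in>B. x \<in> V \<and> V \<subseteq> U)"
    using second_countable_product_base[of I X, OF assms(1,2)] by auto
  have "openin (product_topology X I) V" if "V \<in> B" for V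
    using B(2) that assms(1) by (fastforce simp: openin_PiE_gen)
  with B(1,3) show ?thesis unfolding second_countable_def by (intro exI[of _ B]) simp
qed

text \<open>The Borel sets here come from the product topology, not from a product of
  sigma-algebras. A countable base of boxes bridges the two, since the preimage of a box is a finite
  intersection of coordinate preimages.\<close>

lemma measurable_borel_of_product:
  assumes fin: "finite I" and sc: "\<And>i. i \<in> I \<Longrightarrow> second_countable (X i)"
    and f: "\<And>i. i \<in> I \<Longrightarrow> f i \<in> M \<rightarrow>\<^sub>M borel_of (X i)"
  shows "(\<lambda>x. \<lambda>i\<in>I. f i x) \<in> M \<rightarrow>\<^sub>M borel_of (product_topology X I)"
proof -
  obtain B where B: "countable B"
    "\<forall>V\<in>B. \<exists>E. V = PiE I E \<and> (\<forall>i\<in>I. openin (X i) (E i))"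
    "\<forall>U x. openin (product_topology X I) U \<and> x \<in> U \<longrightarrow> (\<exists>V\<in>B. x \<in> V \<and> V \<subseteq> U)"
    using second_countable_product_base[of I X, OF assms(1,2)] by auto
  show ?thesis
  proof (rule measurable_borel_of_base[OF _ B(1)])
    show "(\<lambda>x. \<lambda>i\<in>I. f i x) \<in> space M \<rightarrow> topspace (product_topology X I)"
      using measurable_space[OF f] by (auto simp: space_borel_of)
    show "\<exists>V\<in>B. x \<in> V \<and> V \<subseteq> U" if "openin (product_topology X I) U" "x \<in> U" for U x
      using B(3) that by blast
    fix V assume "V \<in> B"
    from bspec[OF B(2) this] obtain E
      where V: "V = PiE I E" and "\<forall>i\<in>I. openin (X i) (E i)"
      by auto
    then have E: "openin (X i) (E i)" if "i \<in> I" for i using that by auto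
    have "(\<lambda>x. \<lambda>i\<in>I. f i x) -` V \<inter> space M = {x\<in>space M. \<forall>i\<in>I. f i x \<in> E i}"
      by (auto simp: V PiE_iff)
    also have "\<dots> \<in> sets M"
      using fin measurable_sets[OF f openin_in_sets_borel_of[OF E]]
      by (intro sets.sets_Collect_finite_All) (simp_all add: vimage_def Int_def conj_commute)
    finally show "(\<lambda>x. \<lambda>i\<in>I. f i x) -` V \<inter> space M \<in> sets M" .
  qed
qed

lemma measurable_borel_of_Pair:
  assumes "second_countable S" and "second_countable T"
    and f: "f \<in> M \<rightarrow>\<^sub>M borel_of S" and g: "g \<in> M \<rightarrow>\<^sub>M borel_of T"
  shows "(\<lambda>x. (f x, g x)) \<in> M \<rightarrow>\<^sub>M borel_of (prod_topology S T)"
proof -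
  obtain A where A: "countable A" "\<And>V. V \<in> A \<Longrightarrow> openin S V"
    "\<And>U x. openin S U \<Longrightarrow> x \<in> U \<Longrightarrow> \<exists>V\<in>A. x \<in> V \<and> V \<subseteq> U"
    using assms(1) unfolding second_countable_def by metis
  obtain B where B: "countable B" "\<And>V. V \<in> B \<Longrightarrow> openin T V"
    "\<And>U x. openin T U \<Longrightarrow> x \<in> U \<Longrightarrow> \<exists>V\<in>B. x \<in> V \<and> V \<subseteq> U"
    using assms(2) unfolding second_countable_def by metis
  show ?thesis
  proof (rule measurable_borel_of_base)
    let ?B = "(\<lambda>(V, W). V \<times> W) ` (A \<times> B)"
    show "(\<lambda>x. (f x, g x)) \<in> space M \<rightarrow> topspace (prod_topology S T)"
      using measurable_space[OF f] measurable_space[OF g] by (auto simp: space_borel_of)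
    show "countable ?B" using A B by auto
    show "\<exists>V\<in>?B. x \<in> V \<and> V \<subseteq> U" if U: "openin (prod_topology S T) U" "x \<in> U" for U x
    proof -
      obtain V W where VW: "openin S V" "openin T W" "fst x \<in> V" "snd x \<in> W" "V \<times> W \<subseteq> U"
        using U by (metis openin_prod_topology_alt prod.collapse)
      then obtain V' W' where "V' \<in> A" "fst x \<in> V'" "V' \<subseteq> V" "W' \<in> B" "snd x \<in> W'" "W' \<subseteq> W"
        using A(3) B(3) by metis
      with VW(5) show ?thesis
        by (intro bexI[of _ "V' \<times> W'"]) (auto simp: mem_Times_iff)
    qed
    fix V assume "V \<in> ?B"
    then obtain P Q where V: "V = P \<times> Q" and "P \<in> A" "Q \<in> B" by auto
    have "(\<lambda>x. (f x, g x)) -` V \<inter> space M = (f -` P \<inter> space M) \<inter> (g -` Q \<inter> space M)"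
      by (auto simp: V)
    also have "\<dots> \<in> sets M"
      using A(2)[OF \<open>P \<in> A\<close>] B(2)[OF \<open>Q \<in> B\<close>]
      by (intro sets.Int measurable_sets[OF f] measurable_sets[OF g] openin_in_sets_borel_of)
    finally show "(\<lambda>x. (f x, g x)) -` V \<inter> space M \<in> sets M" .
  qed
qed

text \<open>The complement of the graph is a countable union of measurable rectangles: if
  \<open>z \<noteq> f x\<close>, the Hausdorff property yields a basic \<open>V\<close> that
  contains \<open>z\<close> but not \<open>f x\<close>. This later turns an equality of laws into an
  almost sure identity.\<close>

lemma graph_measurable_borel_of:
  assumes "Hausdorff_space T" and "second_countable T" and f: "f \<in> M \<rightarrow>\<^sub>M borel_of T"
  shows "{(z, x) \<in> space (borel_of T \<Otimes>\<^sub>M M). z = f x} \<in> sets (borel_of T \<Otimes>\<^sub>M M)"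
proof -
  obtain B where B: "countable B" "\<And>V. V \<in> B \<Longrightarrow> openin T V"
    "\<And>U x. openin T U \<Longrightarrow> x \<in> U \<Longrightarrow> \<exists>V\<in>B. x \<in> V \<and> V \<subseteq> U"
    using assms(2) unfolding second_countable_def by metis
  let ?N = "\<Union>V\<in>B. V \<times> (space M - (f -` V \<inter> space M))"
  have mem: "(z, x) \<in> ?N \<longleftrightarrow> z \<noteq> f x" if z: "z \<in> topspace T" and x: "x \<in> space M" for z x
  proof
    assume "(z, x) \<in> ?N"
    then show "z \<noteq> f x" using x by auto
  next
    assume "z \<noteq> f x"
    moreover have "f x \<in> topspace T" using measurable_space[OF f x] by (simp add: space_borel_of)
    ultimately have "\<exists>U W. openin T U \<and> openin T W \<and> z \<in> U \<and> f x \<in> W \<and> disjnt U W"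
      using assms(1)[unfolded Hausdorff_space_def, rule_format, of z "f x"] z by simp
    then obtain U W where U: "openin T U" "z \<in> U" and W: "f x \<in> W" "disjnt U W"
      by (elim exE conjE)
    obtain V where V: "V \<in> B" "z \<in> V" "V \<subseteq> U"
      using B(3)[OF U] by blast
    have "f x \<notin> V" using V(3) W unfolding disjnt_iff by blast
    then show "(z, x) \<in> ?N"
      using x by (intro UN_I[OF V(1)]) (simp add: V(2))
  qed
  have "{(z, x) \<in> space (borel_of T \<Otimes>\<^sub>M M). z = f x} = space (borel_of T \<Otimes>\<^sub>M M) - ?N"
    using mem by (simp add: set_eq_iff space_pair_measure space_borel_of del: UN_iff) metis
  also have "\<dots> \<in> sets (borel_of T \<Otimes>\<^sub>M M)"
  proof (intro sets.Diff sets.top sets.countable_UN'' B(1) pair_measureI measurable_sets[OF f])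
    fix V assume "V \<in> B"
    then show "V \<in> sets (borel_of T)" by (rule openin_in_sets_borel_of[OF B(2)])
  qed (rule openin_in_sets_borel_of[OF B(2)])
  finally show ?thesis .
qed

section \<open>Coding a Polish space by real numbers\<close>

text \<open>Only the digits 0 and 1 occur, so tails are at most 1/2 and the digits can be read off by \<open>floor\<close>.\<close>

definition ternary :: "(nat \<Rightarrow> bool) \<Rightarrow> real" where
  "ternary b = (\<Sum>n. of_bool (b n) / 3 ^ Suc n)"

definition digit :: "nat \<Rightarrow> real \<Rightarrow> bool" where
  "digit n t \<longleftrightarrow> \<lfloor>3 ^ Suc n * t\<rfloor> mod 3 = 1"

section \<open>Recovering the digits of a ternary series\<close>

lemma third_sums: "(\<lambda>n. 1 / 3 ^ Suc n) sums (1 / 2 :: real)"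
  using sums_mult[OF geometric_sums[of "1/3::real"], of "1/3"]
  by (simp add: power_divide)

lemma summable_ternary: "summable (\<lambda>n. of_bool (b n) / 3 ^ Suc n :: real)"
  by (rule summable_comparison_test'[OF sums_summable[OF third_sums], of 0])
    (auto simp: of_bool_def)

lemma ternary_nonneg: "0 \<le> ternary b"
  unfolding ternary_def by (intro suminf_nonneg summable_ternary) auto

lemma ternary_le_half: "ternary b \<le> 1 / 2"
  unfolding ternary_def sums_unique[OF third_sums]
  by (intro suminf_le summable_ternary sums_summable[OF third_sums]) (auto simp: of_bool_def)

lemma ternary_Suc: "3 * ternary b = of_bool (b 0) + ternary (\<lambda>n. b (Suc n))"
proof -
  have "ternary b = of_bool (b 0) / 3 + (\<Sum>n. of_bool (b (Suc n)) / 3 ^ Suc (Suc n))"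
    unfolding ternary_def using suminf_split_head[OF summable_ternary[of b]] by simp
  also have "(\<Sum>n. of_bool (b (Suc n)) / 3 ^ Suc (Suc n)) = ternary (\<lambda>n. b (Suc n)) / 3"
    unfolding ternary_def
    by (subst suminf_divide[symmetric, OF summable_ternary]) (simp add: field_simps)
  finally show ?thesis by simp
qed

text \<open>For digit 0, the tail lies in [0, 1/2], so the floor of \<open>3 * ternary b\<close> is
  the leading digit. For later digits, the leading digit adds a multiple of 3 to the floor and
  disappears modulo 3, which leaves the shifted sequence.\<close>

lemma digit_ternary: "digit n (ternary b) \<longleftrightarrow> b n"
proof (induction n arbitrary: b)
  case 0
  have "\<lfloor>3 * ternary b\<rfloor> = of_bool (b 0)"
    using ternary_nonneg[of "\<lambda>n. b (Suc n)"] ternary_le_half[of "\<lambda>n. b (Suc n)"]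
    unfolding ternary_Suc by (intro floor_unique) auto
  then show ?case by (simp add: digit_def)
next
  case (Suc n)
  have "3 ^ Suc (Suc n) * ternary b
      = of_int (3 ^ Suc n * of_bool (b 0)) + 3 ^ Suc n * ternary (\<lambda>n. b (Suc n))"
  proof -
    have "3 ^ Suc (Suc n) * ternary b = 3 ^ Suc n * (3 * ternary b)" by simp
    then show ?thesis unfolding ternary_Suc distrib_left by simp
  qed
  then have "\<lfloor>3 ^ Suc (Suc n) * ternary b\<rfloor>
      = 3 * (3 ^ n * of_bool (b 0)) + \<lfloor>3 ^ Suc n * ternary (\<lambda>n. b (Suc n))\<rfloor>"
    by (simp only: int_add_floor[symmetric]) simp
  then have "digit (Suc n) (ternary b) \<longleftrightarrow> digit n (ternary (\<lambda>n. b (Suc n)))"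
    by (simp only: digit_def mod_mult_self4)
  with Suc.IH show ?case by simp
qed

section \<open>Encoding and decoding points of a Polish space\<close>

lemma measurable_digit [measurable]: "Measurable.pred borel (digit n)"
  unfolding digit_def by measurable

lemma measurable_ternary:
  assumes [measurable]: "\<And>n. Measurable.pred M (\<lambda>x. b x n)"
  shows "(\<lambda>x. ternary (b x)) \<in> borel_measurable M"
  unfolding ternary_def of_bool_def by measurable

text \<open>A point is coded by the answers to all questions "is it within \<open>1 / 2 ^ m\<close>
  of the \<open>j\<close>-th dense point?", packed into one real number. Reading off, for each
  \<open>m\<close>, the first \<open>j\<close> answered with yes gives dense points converging to
  the coded point. This reduces the construction of conditional laws to the real line.\<close>

lemma Polish_space_real_coding:
  assumes "Polish_space T" and "topspace T \<noteq> {}"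
  obtains \<phi> :: "'a \<Rightarrow> real" and g :: "real \<Rightarrow> 'a"
  where "\<phi> \<in> borel_measurable (borel_of T)" and "\<And>x. 0 \<le> \<phi> x" and "\<And>x. \<phi> x \<le> 1"
    and "g \<in> borel \<rightarrow>\<^sub>M borel_of T" and "\<And>x. x \<in> topspace T \<Longrightarrow> g (\<phi> x) = x"
proof -
  obtain M d where m: "Metric_space M d" and comp: "Metric_space.mcomplete M d"
      and T: "T = Metric_space.mtopology M d"
    using assms by (auto simp: Polish_space_def completely_metrizable_space_def)
  interpret Metric_space M d by fact
  have sM: "space (borel_of T) = M" by (simp add: space_borel_of T)
  obtain D where D: "countable D" "D \<subseteq> M" and dense: "mtopology closure_of D = M"
    using assms by (auto simp: Polish_space_def separable_space_def T)
  have "D \<noteq> {}" using assms(2) dense by (auto simp: T)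
  define e where "e = from_nat_into D"
  have eM: "e j \<in> M" for j
    using from_nat_into[OF \<open>D \<noteq> {}\<close>] D by (auto simp: e_def)
  have near: "\<exists>j. d x (e j) < r" if "x \<in> M" "r > 0" for x r
  proof -
    have "\<forall>r>0. \<exists>y\<in>D. y \<in> mball x r"
      using \<open>x \<in> M\<close> dense unfolding metric_closure_of by blast
    then obtain y where "y \<in> D" "y \<in> mball x r"
      using \<open>r > 0\<close> by blast
    moreover obtain j where "y = e j"
      using \<open>y \<in> D\<close> from_nat_into_surj[OF D(1)] unfolding e_def by metis
    ultimately show ?thesis by auto
  qed
  define b where "b x n = (case prod_decode n of (m, j) \<Rightarrow> d x (e j) < 1 / 2 ^ m)" for x n
  \<comment> \<open>For a real number without a matching digit \<open>LEAST\<close> still returns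
    some index, so \<open>s t m\<close> lies in \<open>M\<close> for every \<open>t\<close>.\<close>
  define J where "J t m = (LEAST j. digit (prod_encode (m, j)) t)" for t m
  define s where "s t m = e (J t m)" for t m
  \<comment> \<open>On the range of \<open>ternary \<circ> b\<close>, \<open>s t m\<close> has distance less than \<open>1 / 2 ^ m\<close> from the coded point.
    Extending the decoder by limits on all of \<open>C\<close> avoids proving that this range is Borel.\<close>
  define C where "C = {t. \<exists>y. limitin mtopology (s t) y sequentially}"
  define g where "g t = (if t \<in> C then (SOME y. limitin mtopology (s t) y sequentially) else e 0)" for t
  have sM': "s t m \<in> M" for t m by (simp add: s_def eM)
  have glim: "limitin mtopology (s t) (g t) sequentially" if "t \<in> C" for t
    using that someI_ex[of "\<lambda>y. limitin mtopology (s t) y sequentially"] by (auto simp: g_def C_def)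
  have gM: "g t \<in> M" for t
    using glim[of t] eM by (cases "t \<in> C") (auto dest: limitin_mspace simp: g_def)
  have [measurable]: "(\<lambda>t. J t m) \<in> borel \<rightarrow>\<^sub>M count_space UNIV" for m
    unfolding J_def by measurable
  \<comment> \<open>Completeness replaces the existence of a limit by the Cauchy condition. With
    tolerances \<open>1 / real (Suc k)\<close> all quantifiers are countable, which makes
    \<open>C\<close> Borel.\<close>
  have Ceq: "C = {t. \<forall>k. \<exists>N. \<forall>n\<ge>N. \<forall>n'\<ge>N. d (s t n) (s t n') < 1 / real (Suc k)}"
  proof -
    have "t \<in> C \<longleftrightarrow> MCauchy (s t)" for t
      using comp convergent_imp_MCauchy[of "s t"] sM' by (auto simp: C_def mcomplete_def)
    moreover have "MCauchy (s t) \<longleftrightarrow> (\<forall>k. \<exists>N. \<forall>n\<ge>N. \<forall>n'\<ge>N. d (s t n) (s t n') < 1 / real (Suc k))" for t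
    proof
      assume "MCauchy (s t)"
      then show "\<forall>k. \<exists>N. \<forall>n\<ge>N. \<forall>n'\<ge>N. d (s t n) (s t n') < 1 / real (Suc k)"
        unfolding MCauchy_def by (meson of_nat_0_less_iff zero_less_Suc zero_less_divide_1_iff)
    next
      assume *: "\<forall>k. \<exists>N. \<forall>n\<ge>N. \<forall>n'\<ge>N. d (s t n) (s t n') < 1 / real (Suc k)"
      show "MCauchy (s t)" unfolding MCauchy_def
      proof (intro conjI allI impI)
        show "range (s t) \<subseteq> M" using sM' by auto
        fix r :: real assume "r > 0"
        then obtain k where "1 / real (Suc k) < r" by (metis nat_approx_posE)
        with * show "\<exists>N. \<forall>n n'. N \<le> n \<longrightarrow> N \<le> n' \<longrightarrow> d (s t n) (s t n') < r"
          by (meson order.strict_trans)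
      qed
    qed
    ultimately show ?thesis by blast
  qed
  have [measurable]: "C \<in> sets borel"
    unfolding Ceq s_def by measurable
  \<comment> \<open>Distances to a fixed point are pointwise limits of Borel real functions; since
    preimages of balls are sublevel sets of such distances, this suffices for the measurability of
    \<open>g\<close>.\<close>
  have dist: "(\<lambda>t. d (g t) y) \<in> borel_measurable borel" if "y \<in> M" for y
  proof (rule borel_measurable_LIMSEQ_real)
    show "(\<lambda>t. if t \<in> C then d (s t n) y else d (e 0) y) \<in> borel_measurable borel" for n
      unfolding s_def by measurable
    show "(\<lambda>n. if t \<in> C then d (s t n) y else d (e 0) y) \<longlonglongrightarrow> d (g t) y" for t
    proof (cases "t \<in> C")
      case True
      have lim: "(\<lambda>n. d (s t n) (g t)) \<longlonglongrightarrow> 0"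
        using glim[OF True] limitin_metric_dist_null by blast
      have le: "dist (d (s t n) y) (d (g t) y) \<le> d (s t n) (g t)" for n
        using mdist_reverse_triangle[of "s t n" y "g t"] sM' gM that
        by (simp add: dist_real_def commute)
      have "(\<lambda>n. d (s t n) y) \<longlonglongrightarrow> d (g t) y"
        by (rule metric_tendsto_imp_tendsto[OF lim]) (simp add: le)
      with True show ?thesis by simp
    qed (simp add: g_def)
  qed
  show ?thesis
  proof (rule that)
    show "(\<lambda>x. ternary (b x)) \<in> borel_measurable (borel_of T)"
    proof (rule measurable_ternary)
      fix n
      obtain m j where n: "prod_decode n = (m, j)" by force
      have "{x \<in> space (borel_of T). b x n} = mball (e j) (1 / 2 ^ m)"
        using eM by (auto simp: sM b_def n commute)
      then show "Measurable.pred (borel_of T) (\<lambda>x. b x n)"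
        by (simp add: pred_def openin_in_sets_borel_of T)
    qed
    show "0 \<le> ternary (b x)" for x by (rule ternary_nonneg)
    show "ternary (b x) \<le> 1" for x using ternary_le_half[of "b x"] by simp
    show "g (ternary (b x)) = x" if x: "x \<in> topspace T" for x
    proof -
      have xM: "x \<in> M" using x by (simp add: T)
      have close: "d (s (ternary (b x)) m) x < 1 / 2 ^ m" for m
      proof -
        have "\<exists>j. digit (prod_encode (m, j)) (ternary (b x))"
          using near[OF xM, of "1 / 2 ^ m"] by (simp add: digit_ternary b_def)
        then have "digit (prod_encode (m, J (ternary (b x)) m)) (ternary (b x))"
          unfolding J_def by (rule LeastI_ex)
        then show ?thesis by (simp add: digit_ternary b_def s_def commute)
      qed
      have "limitin mtopology (s (ternary (b x))) x sequentially"
        unfolding limitin_metric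
      proof (intro conjI allI impI xM)
        fix r :: real assume "r > 0"
        have "(\<lambda>m. (1 / 2 :: real) ^ m) \<longlonglongrightarrow> 0" by (intro LIMSEQ_power_zero) auto
        then have "\<forall>\<^sub>F m in sequentially. (1 / 2 :: real) ^ m < r"
          using \<open>r > 0\<close> by (auto intro: order_tendstoD)
        then show "\<forall>\<^sub>F m in sequentially. s (ternary (b x)) m \<in> M \<and> d (s (ternary (b x)) m) x < r"
          by eventually_elim (use close sM' in \<open>force simp: power_one_over intro: order.strict_trans\<close>)
      qed
      then have "ternary (b x) \<in> C" "limitin mtopology (s (ternary (b x))) x sequentially"
        by (auto simp: C_def)
      then show ?thesis
        using glim limitin_metric_unique trivial_limit_sequentially by blast
    qed
    show "g \<in> borel \<rightarrow>\<^sub>M borel_of T"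
    proof (rule measurable_borel_of_base)
      let ?B = "(\<lambda>(j, n). mball (e j) (1 / real (Suc n))) ` UNIV"
      show "g \<in> space borel \<rightarrow> topspace T" using gM by (auto simp: T)
      show "countable ?B" by simp
      show "g -` V \<inter> space borel \<in> sets borel" if V: "V \<in> ?B" for V
      proof -
        obtain j n where V: "V = mball (e j) (1 / real (Suc n))" using V by auto
        have "g -` V \<inter> space borel = {t \<in> space borel. d (g t) (e j) < 1 / real (Suc n)}"
          using gM eM by (auto simp: V commute)
        also have "\<dots> \<in> sets borel" using dist[OF eM] by measurable
        finally show ?thesis .
      qed
      show "\<exists>V\<in>?B. x \<in> V \<and> V \<subseteq> U" if U: "openin T U" "x \<in> U" for U x
      proof -
        obtain y n where "y \<in> D" "x \<in> mball y (1 / real (Suc n))"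
            "mball y (1 / real (Suc n)) \<subseteq> U"
          using dense_ball_base[OF D(2) dense] U unfolding T by metis
        moreover obtain j where "y = e j"
          using \<open>y \<in> D\<close> from_nat_into_surj[OF D(1)] unfolding e_def by metis
        ultimately show ?thesis
          by (intro bexI[of _ "mball (e j) (1 / real (Suc n))"]) auto
      qed
    qed
  qed
qed

section \<open>Conditional distributions and randomized sections\<close>

text \<open>A uniform seed falls below a level with probability equal to that level. Negative
  \<open>u\<close>, which \<open>ennreal\<close> sends to 0, are cut off by the interval.\<close>

lemma emeasure_uniform_lessThan:
  assumes "c \<le> 1"
  shows "emeasure (uniform_measure lborel {0..1::real}) {u. ennreal u < c} = c"
proof -
  obtain r where r: "c = ennreal r" "0 \<le> r" "r \<le> 1"
    using assms by (cases c) (auto simp: top_unique)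
  have "{0..1} \<inter> {u. ennreal u < c} = {0..<r}"
    using r by (auto simp: ennreal_less_iff)
  then show ?thesis using r by (simp add: emeasure_uniform_measure divide_ennreal flip: ennreal_1)
qed

text \<open>For fixed \<open>A\<close>, a finite measure on the line is determined by its values on
  upper half-lines, which gives agreement on all rectangles \<open>A \<times> B\<close>; rectangles
  are stable under intersection and generate the product sigma-algebra.\<close>

lemma measure_eqI_pair_greaterThan:
  fixes M M' :: "('z \<times> real) measure"
  assumes "finite_measure M" and sets: "sets M = sets (N \<Otimes>\<^sub>M borel)" "sets M' = sets (N \<Otimes>\<^sub>M borel)"
    and eq: "\<And>A x. A \<in> sets N \<Longrightarrow> emeasure M (A \<times> {x<..}) = emeasure M' (A \<times> {x<..})"
  shows "M = M'"
proof -
  interpret finite_measure M by fact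
  \<comment> \<open>The slice measure sending \<open>B\<close> to \<open>K (A \<times> B)\<close>:
    restrict \<open>K\<close> to the strip over \<open>A\<close>, then project to the line.\<close>
  define D where "D K A = distr (density K (indicator (A \<times> UNIV))) borel snd"
    for K :: "('z \<times> real) measure" and A
  have D: "emeasure (D K A) B = emeasure K (A \<times> B)"
    if K: "sets K = sets (N \<Otimes>\<^sub>M borel)" and A: "A \<in> sets N" and B: "B \<in> sets borel" for K A B
  proof -
    have [measurable_cong]: "sets K = sets (N \<Otimes>\<^sub>M borel)" by fact
    have AU: "A \<times> UNIV \<in> sets K" unfolding K using A by (intro pair_measureI) auto
    have m: "snd \<in> K \<rightarrow>\<^sub>M borel" by measurable
    have B': "snd -` B \<inter> space K \<in> sets K" using measurable_sets[OF m B] .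
    have AB: "A \<times> B \<subseteq> space K"
      using sets.sets_into_space[OF AU] by auto
    have "emeasure (D K A) B = emeasure (density K (indicator (A \<times> UNIV))) (snd -` B \<inter> space K)"
      unfolding D_def by (subst emeasure_distr) (use m B in auto)
    also have "\<dots> = (\<integral>\<^sup>+p. indicator (A \<times> UNIV) p * indicator (snd -` B \<inter> space K) p \<partial>K)"
      by (rule emeasure_density) (use AU B' in auto)
    also have "\<dots> = (\<integral>\<^sup>+p. indicator (A \<times> B) p \<partial>K)"
      by (rule nn_integral_cong) (auto simp: indicator_def)
    also have "\<dots> = emeasure K (A \<times> B)"
      by (rule nn_integral_indicator) (use A B in \<open>auto simp: K\<close>)
    finally show ?thesis .
  qed
  have rect: "emeasure M (A \<times> B) = emeasure M' (A \<times> B)" if "A \<in> sets N" "B \<in> sets borel" for A B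
  proof -
    have "D M A = D M' A"
    proof (rule measure_eqI_lessThan)
      fix x :: real
      show "emeasure (D M A) {x<..} < \<infinity>"
        using D[OF sets(1) that(1)] emeasure_finite by (simp add: less_top[symmetric])
      show "emeasure (D M A) {x<..} = emeasure (D M' A) {x<..}"
        using D[OF sets(1) that(1)] D[OF sets(2) that(1)] eq[OF that(1)] by simp
    qed (simp_all add: D_def)
    then show ?thesis using D[OF sets(1) that] D[OF sets(2) that] by simp
  qed
  show ?thesis
  proof (rule measure_eqI_generator_eq[OF Int_stable_pair_measure_generator[of N borel]])
    show "{a \<times> b |a b. a \<in> sets N \<and> b \<in> sets (borel :: real measure)} \<subseteq> Pow (space N \<times> space borel)"
      by (auto dest: sets.sets_into_space)
    show "sets M = sigma_sets (space N \<times> space borel) {a \<times> b |a b. a \<in> sets N \<and> b \<in> sets borel}"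
      "sets M' = sigma_sets (space N \<times> space borel) {a \<times> b |a b. a \<in> sets N \<and> b \<in> sets borel}"
      by (simp_all add: sets sets_pair_measure)
    show "range (\<lambda>_::nat. space N \<times> space borel) \<subseteq> {a \<times> b |a b. a \<in> sets N \<and> b \<in> sets (borel :: real measure)}"
      by blast
    show "emeasure M (space N \<times> space borel) \<noteq> \<infinity>" by simp
  qed (auto simp: rect)
qed

section \<open>Conditional probabilities by Radon-Nikodym derivatives\<close>

text \<open>\<open>f z\<close> is the conditional probability of \<open>E\<close> given
  \<open>l = z\<close>. The image under \<open>l\<close> of \<mu> restricted to \<open>E\<close> is
  dominated by the law of \<open>l\<close>, and \<open>f\<close> is its density.\<close>

lemma conditional_probability_exists:
  assumes "prob_space \<mu>" and l: "l \<in> \<mu> \<rightarrow>\<^sub>M N" and E: "E \<in> sets \<mu>"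
  shows "\<exists>f. f \<in> borel_measurable N \<and>
    (\<forall>A\<in>sets N. (\<integral>\<^sup>+z. f z * indicator A z \<partial>distr \<mu> N l) = emeasure \<mu> (E \<inter> (l -` A \<inter> space \<mu>)))"
proof -
  interpret prob_space \<mu> by fact
  interpret \<nu>: prob_space "distr \<mu> N l" by (rule prob_space_distr[OF l])
  define R where "R = distr (density \<mu> (indicator E)) N l"
  have R: "emeasure R A = emeasure \<mu> (E \<inter> (l -` A \<inter> space \<mu>))" if A: "A \<in> sets N" for A
  proof -
    have "emeasure R A = emeasure (density \<mu> (indicator E)) (l -` A \<inter> space \<mu>)"
      unfolding R_def by (subst emeasure_distr) (use l A in auto)
    also have "\<dots> = (\<integral>\<^sup>+x. indicator E x * indicator (l -` A \<inter> space \<mu>) x \<partial>\<mu>)"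
      by (rule emeasure_density) (use E measurable_sets[OF l A] in auto)
    also have "\<dots> = (\<integral>\<^sup>+x. indicator (E \<inter> (l -` A \<inter> space \<mu>)) x \<partial>\<mu>)"
      by (simp add: indicator_inter_arith)
    also have "\<dots> = emeasure \<mu> (E \<inter> (l -` A \<inter> space \<mu>))"
      by (rule nn_integral_indicator) (use E measurable_sets[OF l A] in auto)
    finally show ?thesis .
  qed
  have "absolutely_continuous (distr \<mu> N l) R"
    unfolding absolutely_continuous_def
  proof
    fix A assume "A \<in> null_sets (distr \<mu> N l)"
    then have A: "A \<in> sets N" and 0: "emeasure \<mu> (l -` A \<inter> space \<mu>) = 0"
      by (auto simp: null_sets_def emeasure_distr[OF l])
    have "emeasure R A = 0"
      unfolding R[OF A] by (rule emeasure_eq_0[OF measurable_sets[OF l A] 0]) auto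
    with A show "A \<in> null_sets R" by (auto simp: null_sets_def R_def)
  qed
  then have "density (distr \<mu> N l) (RN_deriv (distr \<mu> N l) R) = R"
    by (rule \<nu>.density_RN_deriv) (simp add: R_def)
  then have "(\<integral>\<^sup>+z. RN_deriv (distr \<mu> N l) R z * indicator A z \<partial>distr \<mu> N l)
      = emeasure \<mu> (E \<inter> (l -` A \<inter> space \<mu>))" if "A \<in> sets N" for A
    using emeasure_density[of "RN_deriv (distr \<mu> N l) R" "distr \<mu> N l" A] R[OF that] that by simp
  moreover have "RN_deriv (distr \<mu> N l) R \<in> borel_measurable N"
    using borel_measurable_RN_deriv[of "distr \<mu> N l" R] by simp
  ultimately show ?thesis by blast
qed

text \<open>Adding to \<open>f\<close> the conditional probability of \<open>E' - E\<close> gives a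
  function with the same integrals as \<open>f'\<close>, hence equal to \<open>f'\<close> almost
  everywhere by uniqueness of densities. The added function is nonnegative, and no subtraction in
  \<open>ennreal\<close> occurs.\<close>

lemma conditional_probability_mono:
  assumes "prob_space \<mu>" and l: "l \<in> \<mu> \<rightarrow>\<^sub>M N" and E: "E \<in> sets \<mu>" "E' \<in> sets \<mu>" "E \<subseteq> E'"
    and [measurable]: "f \<in> borel_measurable N" "f' \<in> borel_measurable N"
    and f: "\<And>A. A \<in> sets N \<Longrightarrow>
      (\<integral>\<^sup>+z. f z * indicator A z \<partial>distr \<mu> N l) = emeasure \<mu> (E \<inter> (l -` A \<inter> space \<mu>))"
    and f': "\<And>A. A \<in> sets N \<Longrightarrow>
      (\<integral>\<^sup>+z. f' z * indicator A z \<partial>distr \<mu> N l) = emeasure \<mu> (E' \<inter> (l -` A \<inter> space \<mu>))"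
  shows "AE z in distr \<mu> N l. f z \<le> f' z"
proof -
  interpret prob_space \<mu> by fact
  interpret \<nu>: prob_space "distr \<mu> N l" by (rule prob_space_distr[OF l])
  have "E' - E \<in> sets \<mu>" using E by blast
  from conditional_probability_exists[OF assms(1) l this]
  obtain g where [measurable]: "g \<in> borel_measurable N"
    and g: "\<And>A. A \<in> sets N \<Longrightarrow>
      (\<integral>\<^sup>+z. g z * indicator A z \<partial>distr \<mu> N l) = emeasure \<mu> ((E' - E) \<inter> (l -` A \<inter> space \<mu>))"
    by auto
  have "density (distr \<mu> N l) (\<lambda>z. f z + g z) = density (distr \<mu> N l) f'"
  proof (rule measure_eqI)
    fix A assume "A \<in> sets (density (distr \<mu> N l) (\<lambda>z. f z + g z))"
    then have A [measurable]: "A \<in> sets N" by simp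
    have "emeasure (density (distr \<mu> N l) (\<lambda>z. f z + g z)) A
        = (\<integral>\<^sup>+z. f z * indicator A z + g z * indicator A z \<partial>distr \<mu> N l)"
      by (subst emeasure_density) (auto simp: distrib_right)
    also have "\<dots> = emeasure \<mu> (E \<inter> (l -` A \<inter> space \<mu>)) + emeasure \<mu> ((E' - E) \<inter> (l -` A \<inter> space \<mu>))"
      by (subst nn_integral_add) (auto simp: f g)
    also have "\<dots> = emeasure \<mu> (E \<inter> (l -` A \<inter> space \<mu>) \<union> (E' - E) \<inter> (l -` A \<inter> space \<mu>))"
      using E measurable_sets[OF l A] by (intro plus_emeasure) auto
    also have "E \<inter> (l -` A \<inter> space \<mu>) \<union> (E' - E) \<inter> (l -` A \<inter> space \<mu>) = E' \<inter> (l -` A \<inter> space \<mu>)"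
      using E(3) by auto
    also have "emeasure \<mu> \<dots> = emeasure (density (distr \<mu> N l) f') A"
      by (subst emeasure_density) (auto simp: f')
    finally show "emeasure (density (distr \<mu> N l) (\<lambda>z. f z + g z)) A
        = emeasure (density (distr \<mu> N l) f') A" .
  qed simp
  then have "AE z in distr \<mu> N l. f z + g z = f' z"
    by (intro \<nu>.density_unique) auto
  then show ?thesis
    by (rule AE_mp) (metis (mono_tags, lifting) AE_I2 le_iff_add)
qed

text \<open>\<open>G q z\<close> is a version of the conditional probability of
  \<open>of_rat q < \<phi>\<close> given \<open>l = z\<close>. Rational thresholds leave only
  countably many exceptional null sets.\<close>

lemma conditional_survival_function:
  fixes \<phi> :: "'a \<Rightarrow> real"
  assumes "prob_space \<mu>" and l: "l \<in> \<mu> \<rightarrow>\<^sub>M N" and \<phi> [measurable]: "\<phi> \<in> borel_measurable \<mu>"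
  obtains G :: "rat \<Rightarrow> 'z \<Rightarrow> ennreal"
  where "\<And>q. G q \<in> borel_measurable N" and "\<And>q z. G q z \<le> 1" and "\<And>q r z. q \<le> r \<Longrightarrow> G r z \<le> G q z"
    and "\<And>q A. A \<in> sets N \<Longrightarrow> (\<integral>\<^sup>+z. G q z * indicator A z \<partial>distr \<mu> N l)
      = emeasure \<mu> {x \<in> space \<mu>. l x \<in> A \<and> of_rat q < \<phi> x}"
proof -
  interpret prob_space \<mu> by fact
  define E where "E q = {x \<in> space \<mu>. of_rat q < \<phi> x}" for q
  have E: "E q \<in> sets \<mu>" for q unfolding E_def by measurable
  obtain F where [measurable]: "\<And>q. F q \<in> borel_measurable N"
    and F: "\<And>q A. A \<in> sets N \<Longrightarrow>
      (\<integral>\<^sup>+z. F q z * indicator A z \<partial>distr \<mu> N l) = emeasure \<mu> (E q \<inter> (l -` A \<inter> space \<mu>))"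
    using conditional_probability_exists[OF assms(1) l E] by metis
  \<comment> \<open>The \<open>F q\<close> are antimonotone in \<open>q\<close> only almost everywhere; \<open>G\<close> is a version that is so everywhere.\<close>
  define G where "G q z = min 1 (SUP r\<in>{q..}. F r z)" for q z
  have G [measurable]: "G q \<in> borel_measurable N" for q
    unfolding G_def by measurable
  have sub: "E r \<subseteq> E q" if "q \<le> r" for q r
  proof -
    have "real_of_rat q \<le> real_of_rat r" using that by (simp add: of_rat_less_eq)
    then show ?thesis by (auto simp: E_def)
  qed
  have mono: "AE z in distr \<mu> N l. F r z \<le> F q z" if "q \<le> r" for q r
    by (rule conditional_probability_mono[OF assms(1) l E E sub[OF that] _ _ F F]) auto
  have le1: "AE z in distr \<mu> N l. F q z \<le> 1" for q
  \<comment> \<open>The constant 1 is the conditional probability of the whole space, so the bound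
    is another instance of monotonicity.\<close>
  proof (rule conditional_probability_mono[OF assms(1) l E sets.top _ _ _ F])
    show "E q \<subseteq> space \<mu>" by (auto simp: E_def)
    show "(\<integral>\<^sup>+z. 1 * indicator A z \<partial>distr \<mu> N l) = emeasure \<mu> (space \<mu> \<inter> (l -` A \<inter> space \<mu>))"
      if "A \<in> sets N" for A
      using that by (simp add: emeasure_distr[OF l] Int_absorb1)
  qed simp_all
  have all: "AE z in distr \<mu> N l. \<forall>r. q \<le> r \<longrightarrow> F r z \<le> F q z" for q
    unfolding AE_all_countable using mono by (auto intro: AE_impI)
  \<comment> \<open>Off a null set the supremum is attained at \<open>r = q\<close> and the cap at 1
    is inactive, so passing from \<open>F q\<close> to \<open>G q\<close> does not change
    integrals.\<close>
  have GF: "AE z in distr \<mu> N l. G q z = F q z" for q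
    using all[of q] le1[of q]
  proof eventually_elim
    case (elim z)
    then have "(SUP r\<in>{q..}. F r z) = F q z"
      by (intro antisym SUP_least SUP_upper2[of q]) auto
    with elim show ?case by (simp add: G_def)
  qed
  have int: "(\<integral>\<^sup>+z. G q z * indicator A z \<partial>distr \<mu> N l)
      = (\<integral>\<^sup>+z. F q z * indicator A z \<partial>distr \<mu> N l)" for q A
    by (rule nn_integral_cong_AE) (use GF[of q] in \<open>eventually_elim, simp\<close>)
  show ?thesis
  proof (rule that[OF G])
    show "G q z \<le> 1" for q z by (simp add: G_def)
    show "G r z \<le> G q z" if "q \<le> r" for q r z
      unfolding G_def using that by (intro min.mono SUP_subset_mono) auto
    fix q A assume A: "A \<in> sets N"
    have "E q \<inter> (l -` A \<inter> space \<mu>) = {x \<in> space \<mu>. l x \<in> A \<and> of_rat q < \<phi> x}"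
      by (auto simp: E_def)
    then show "(\<integral>\<^sup>+z. G q z * indicator A z \<partial>distr \<mu> N l)
        = emeasure \<mu> {x \<in> space \<mu>. l x \<in> A \<and> of_rat q < \<phi> x}"
      by (simp add: int F[OF A])
  qed
qed

text \<open>\<open>T (z, u)\<close> is the supremum of the rationals \<open>q\<close>, clipped to
  [0, 1], with \<open>u < G q z\<close>: the conditional quantile with upper tail probability
  \<open>u\<close>. For \<open>x\<close> in [0, 1), \<open>T\<close> exceeds \<open>x\<close> iff
  \<open>u < G q z\<close> for some rational \<open>q > x\<close>, and given \<open>z\<close> this
  has the conditional probability of \<open>x < \<phi>\<close>. Comparing masses of sets
  \<open>A \<times> {x<..}\<close> then identifies the joint laws.\<close>

lemma noise_outsourcing_real:
  fixes \<phi> :: "'a \<Rightarrow> real" and l :: "'a \<Rightarrow> 'z"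
  assumes "prob_space \<mu>" and l: "l \<in> \<mu> \<rightarrow>\<^sub>M N"
    and \<phi>: "\<phi> \<in> borel_measurable \<mu>" and bounds: "\<And>x. 0 \<le> \<phi> x" "\<And>x. \<phi> x \<le> 1"
  obtains T :: "'z \<times> real \<Rightarrow> real"
  where "T \<in> borel_measurable (N \<Otimes>\<^sub>M borel)"
    and "distr (distr \<mu> N l \<Otimes>\<^sub>M uniform_measure lborel {0..1}) (N \<Otimes>\<^sub>M borel) (\<lambda>p. (fst p, T p))
      = distr \<mu> (N \<Otimes>\<^sub>M borel) (\<lambda>x. (l x, \<phi> x))"
proof -
  interpret prob_space \<mu> by fact
  interpret \<nu>: prob_space "distr \<mu> N l" by (rule prob_space_distr[OF l])
  interpret U: prob_space "uniform_measure lborel {0..1::real}"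
    by (rule prob_space_uniform_measure) auto
  interpret W: pair_prob_space "distr \<mu> N l" "uniform_measure lborel {0..1::real}" ..
  define W where "W = distr \<mu> N l \<Otimes>\<^sub>M uniform_measure lborel {0..1::real}"
  have W_sets [measurable_cong]: "sets W = sets (N \<Otimes>\<^sub>M borel)"
    unfolding W_def by (rule sets_pair_measure_cong) simp_all
  have W_space: "space W = space N \<times> UNIV"
    by (simp add: W_def space_pair_measure)
  obtain G :: "rat \<Rightarrow> 'z \<Rightarrow> ennreal"
    where [measurable]: "\<And>q. G q \<in> borel_measurable N" and G_le: "\<And>q z. G q z \<le> 1"
      and G_mono: "\<And>q r z. q \<le> r \<Longrightarrow> G r z \<le> G q z"
      and G: "\<And>q A. A \<in> sets N \<Longrightarrow> (\<integral>\<^sup>+z. G q z * indicator A z \<partial>distr \<mu> N l)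
        = emeasure \<mu> {x \<in> space \<mu>. l x \<in> A \<and> of_rat q < \<phi> x}"
    using conditional_survival_function[OF assms(1) l \<phi>] by blast
  \<comment> \<open>Clipping keeps the family bounded, so the real supremum behaves; the value 0 for
    rejected \<open>q\<close> is a lower bound of all clipped values and cannot raise the
    supremum.\<close>
  define t where "t q p = (if ennreal (snd p) < G q (fst p) then min 1 (max 0 (real_of_rat q)) else 0)"
    for q and p :: "'z \<times> real"
  define T where "T p = (SUP q. t q p)" for p
  have t_bounds: "0 \<le> t q p" "t q p \<le> 1" for q p by (auto simp: t_def)
  have bdd: "bdd_above (range (\<lambda>q. t q p))" for p
    by (rule bdd_aboveI2) (rule t_bounds(2))
  have [measurable]: "t q \<in> borel_measurable (N \<Otimes>\<^sub>M borel)" for q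
    unfolding t_def by measurable
  have T_meas [measurable]: "T \<in> borel_measurable (N \<Otimes>\<^sub>M borel)"
    unfolding T_def using bdd by (intro borel_measurable_cSUP) auto
  have less_T: "x < T p \<longleftrightarrow> (\<exists>q. x < t q p)" for x p
    unfolding T_def using less_cSUP_iff[OF _ bdd[of p]] by simp
  have T_nonneg: "0 \<le> T p" for p
    unfolding T_def by (rule order_trans[OF t_bounds(1) cSUP_upper[OF UNIV_I bdd]])
  have T_le: "T p \<le> 1" for p
    unfolding T_def by (rule cSUP_least) (simp_all add: t_bounds(2))
  define S where "S A q = {p \<in> space W. fst p \<in> A \<and> ennreal (snd p) < G q (fst p)}" for A q
  have S_sets: "S A q \<in> sets W" if [measurable]: "A \<in> sets N" for A q
    unfolding S_def by measurable
  have S: "emeasure W (S A q) = emeasure \<mu> {x \<in> space \<mu>. l x \<in> A \<and> of_rat q < \<phi> x}"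
    if A: "A \<in> sets N" for A q
  proof -
    \<comment> \<open>Integrate the sections over \<open>z\<close>: for \<open>z\<close> in
      \<open>A\<close> the section consists of the seeds below \<open>G q z\<close>, of uniform mass
      \<open>G q z\<close>.\<close>
    have "emeasure W (S A q)
        = (\<integral>\<^sup>+z. emeasure (uniform_measure lborel {0..1}) (Pair z -` S A q) \<partial>distr \<mu> N l)"
      using S_sets[OF A] unfolding W_def by (rule U.emeasure_pair_measure_alt)
    also have "\<dots> = (\<integral>\<^sup>+z. G q z * indicator A z \<partial>distr \<mu> N l)"
    proof (rule nn_integral_cong)
      fix z assume "z \<in> space (distr \<mu> N l)"
      then have "Pair z -` S A q = (if z \<in> A then {u. ennreal u < G q z} else {})"
        by (auto simp: S_def W_space)
      then show "emeasure (uniform_measure lborel {0..1}) (Pair z -` S A q) = G q z * indicator A z"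
        using emeasure_uniform_lessThan[OF G_le[of q z]] by simp
    qed
    finally show ?thesis using G[OF A] by simp
  qed
  have key: "emeasure W {p \<in> space W. fst p \<in> A \<and> x < T p} = emeasure \<mu> {y \<in> space \<mu>. l y \<in> A \<and> x < \<phi> y}"
    if A: "A \<in> sets N" for A x
  proof -
    \<comment> \<open>Outside [0, 1) both events are trivial, as \<open>T\<close> and \<phi> take
      values in [0, 1]; inside, clipping does not affect the comparison with
      \<open>x\<close>.\<close>
    consider "x < 0" | "1 \<le> x" | "0 \<le> x" "x < 1" by linarith
    then show ?thesis
    proof cases
      case 1
      have "{p \<in> space W. fst p \<in> A \<and> x < T p} = A \<times> UNIV"
        using less_le_trans[OF 1 T_nonneg] sets.sets_into_space[OF A] by (auto simp: W_space)
      moreover have "{y \<in> space \<mu>. l y \<in> A \<and> x < \<phi> y} = l -` A \<inter> space \<mu>"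
        using less_le_trans[OF 1 bounds(1)] by auto
      moreover have "emeasure W (A \<times> UNIV) = emeasure (distr \<mu> N l) A"
        unfolding W_def
        using U.emeasure_pair_measure_Times[of A "distr \<mu> N l" UNIV] A U.emeasure_space_1 by simp
      ultimately show ?thesis using A by (simp add: emeasure_distr[OF l])
    next
      case 2
      then have "{p \<in> space W. fst p \<in> A \<and> x < T p} = {}" "{y \<in> space \<mu>. l y \<in> A \<and> x < \<phi> y} = {}"
        using order_trans[OF T_le 2] order_trans[OF bounds(2) 2] by (auto simp: not_less[symmetric])
      then show ?thesis by (simp only: emeasure_empty)
    next
      case 3
      \<comment> \<open>Running minima of an enumeration of \<open>Q\<close> give a weakly
        decreasing sequence above \<open>x\<close> that eventually drops to or below any given
        rational above \<open>x\<close>. The events for these thresholds increase, so continuity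
        from below applies under both \<open>W\<close> and \<mu>.\<close>
      define Q where "Q = {q. x < real_of_rat q}"
      have "Q \<noteq> {}" using of_rat_dense[of x "x + 1"] by (auto simp: Q_def)
      define e where "e = from_nat_into Q"
      define q where "q n = Min (e ` {..n})" for n :: nat
      have eQ: "e n \<in> Q" for n unfolding e_def by (rule from_nat_into[OF \<open>Q \<noteq> {}\<close>])
      have e_surj: "\<exists>n. r = e n" if "r \<in> Q" for r
        using from_nat_into_surj[OF countableI_type that] unfolding e_def by metis
      have q_in: "q n \<in> e ` {..n}" for n unfolding q_def by (rule Min_in) auto
      have qx: "x < real_of_rat (q n)" for n
        using q_in[of n] eQ by (auto simp: Q_def)
      have q_mono: "q n \<le> q m" if "m \<le> n" for m n
        unfolding q_def using that by (intro Min_antimono) auto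
      have q_le: "\<exists>n. q n \<le> r" if r: "x < real_of_rat r" for r
      proof -
        obtain n where "r = e n" using e_surj[of r] r by (auto simp: Q_def)
        then have "q n \<le> r" unfolding q_def by (intro Min_le) auto
        then show ?thesis by blast
      qed
      have "emeasure W {p \<in> space W. fst p \<in> A \<and> x < T p} = emeasure W (\<Union>n. S A (q n))"
      proof (rule arg_cong[where f = "emeasure W"], rule set_eqI)
        fix p
        have clip: "x < min 1 (max 0 a) \<longleftrightarrow> x < a" for a
          using 3 by (auto simp: min_def max_def)
        have "x < t r p \<longleftrightarrow> x < real_of_rat r \<and> ennreal (snd p) < G r (fst p)" for r
          using 3 clip[of "real_of_rat r"] by (simp add: t_def del: min_less_iff_conj)
        then have "x < T p \<longleftrightarrow> (\<exists>r. x < real_of_rat r \<and> ennreal (snd p) < G r (fst p))"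
          unfolding less_T by simp
        also have "\<dots> \<longleftrightarrow> (\<exists>n. ennreal (snd p) < G (q n) (fst p))"
        proof
          assume "\<exists>r. x < real_of_rat r \<and> ennreal (snd p) < G r (fst p)"
          then obtain r n where "ennreal (snd p) < G r (fst p)" "q n \<le> r" using q_le by blast
          then show "\<exists>n. ennreal (snd p) < G (q n) (fst p)"
            using less_le_trans[OF _ G_mono] by blast
        qed (use qx in blast)
        finally show "p \<in> {p \<in> space W. fst p \<in> A \<and> x < T p} \<longleftrightarrow> p \<in> (\<Union>n. S A (q n))"
          by (auto simp: S_def)
      qed
      also have "\<dots> = (SUP n. emeasure W (S A (q n)))"
      proof (rule SUP_emeasure_incseq[symmetric])
        show "range (\<lambda>n. S A (q n)) \<subseteq> sets W" using S_sets[OF A] by auto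
        show "incseq (\<lambda>n. S A (q n))"
          using less_le_trans[OF _ G_mono[OF q_mono]] by (auto simp: incseq_def S_def)
      qed
      also have "\<dots> = (SUP n. emeasure \<mu> {y \<in> space \<mu>. l y \<in> A \<and> of_rat (q n) < \<phi> y})"
        by (simp add: S[OF A])
      also have "\<dots> = emeasure \<mu> (\<Union>n. {y \<in> space \<mu>. l y \<in> A \<and> of_rat (q n) < \<phi> y})"
      proof (rule SUP_emeasure_incseq)
        note [measurable] = l \<phi> A
        show "range (\<lambda>n. {y \<in> space \<mu>. l y \<in> A \<and> of_rat (q n) < \<phi> y}) \<subseteq> sets \<mu>"
          by (intro image_subsetI) measurable
        have "real_of_rat (q n) \<le> real_of_rat (q m)" if "m \<le> n" for m n
          using q_mono[OF that] by (simp add: of_rat_less_eq)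
        then show "incseq (\<lambda>n. {y \<in> space \<mu>. l y \<in> A \<and> of_rat (q n) < \<phi> y})"
          using le_less_trans by (fastforce simp: incseq_def)
      qed
      also have "(\<Union>n. {y \<in> space \<mu>. l y \<in> A \<and> of_rat (q n) < \<phi> y}) = {y \<in> space \<mu>. l y \<in> A \<and> x < \<phi> y}"
      proof -
        have "(\<exists>n. real_of_rat (q n) < \<phi> y) \<longleftrightarrow> x < \<phi> y" for y
        proof
          assume "x < \<phi> y"
          then obtain r where "x < real_of_rat r" "real_of_rat r < \<phi> y"
            using of_rat_dense by blast
          moreover obtain n where "q n \<le> r" using q_le \<open>x < real_of_rat r\<close> by blast
          then have "real_of_rat (q n) \<le> real_of_rat r" by (simp add: of_rat_less_eq)
          ultimately show "\<exists>n. real_of_rat (q n) < \<phi> y" by (meson order.strict_trans1)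
        next
          assume "\<exists>n. real_of_rat (q n) < \<phi> y"
          then show "x < \<phi> y" using less_trans[OF qx] by blast
        qed
        then show ?thesis by auto
      qed
      finally show ?thesis .
    qed
  qed
  have mT: "(\<lambda>p. (fst p, T p)) \<in> W \<rightarrow>\<^sub>M N \<Otimes>\<^sub>M borel" by measurable
  have ml: "(\<lambda>x. (l x, \<phi> x)) \<in> \<mu> \<rightarrow>\<^sub>M N \<Otimes>\<^sub>M borel" using l \<phi> by measurable
  have "distr W (N \<Otimes>\<^sub>M borel) (\<lambda>p. (fst p, T p)) = distr \<mu> (N \<Otimes>\<^sub>M borel) (\<lambda>x. (l x, \<phi> x))"
  proof (rule measure_eqI_pair_greaterThan)
    have "prob_space W" unfolding W_def by (rule W.prob_space_axioms)
    then show "finite_measure (distr W (N \<Otimes>\<^sub>M borel) (\<lambda>p. (fst p, T p)))"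
      using prob_space.prob_space_distr[OF _ mT] prob_space.finite_measure by blast
    fix A :: "'z set" and x :: real assume A: "A \<in> sets N"
    then have "A \<times> {x<..} \<in> sets (N \<Otimes>\<^sub>M borel)" by (intro pair_measureI) auto
    moreover have "(\<lambda>p. (fst p, T p)) -` (A \<times> {x<..}) \<inter> space W = {p \<in> space W. fst p \<in> A \<and> x < T p}"
      "(\<lambda>x. (l x, \<phi> x)) -` (A \<times> {x<..}) \<inter> space \<mu> = {y \<in> space \<mu>. l y \<in> A \<and> x < \<phi> y}"
      by auto
    ultimately show "emeasure (distr W (N \<Otimes>\<^sub>M borel) (\<lambda>p. (fst p, T p))) (A \<times> {x<..})
        = emeasure (distr \<mu> (N \<Otimes>\<^sub>M borel) (\<lambda>x. (l x, \<phi> x))) (A \<times> {x<..})"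
      using key[OF A, of x] by (simp add: emeasure_distr[OF mT] emeasure_distr[OF ml])
  qed simp_all
  then show ?thesis using that[OF T_meas] by (simp add: W_def)
qed

section \<open>Randomized sections of Borel maps\<close>

lemma Polish_space_imp_Hausdorff_space: "Polish_space T \<Longrightarrow> Hausdorff_space T"
  unfolding Polish_space_def
  by (blast intro: completely_metrizable_imp_metrizable_space metrizable_imp_Hausdorff_space)

text \<open>The real-valued case is applied to the code \<phi> and its output is decoded by
  \<open>g\<close>; since \<open>g\<close> undoes \<phi> on \<open>topspace S\<close>, the joint law
  becomes that of \<open>(l x, x)\<close>.\<close>

lemma noise_outsourcing:
  fixes S :: "'a topology" and l :: "'a \<Rightarrow> 'z"
  assumes S: "Polish_space S" and \<mu>: "\<mu> \<in> prob_measures S" and l: "l \<in> borel_of S \<rightarrow>\<^sub>M N"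
  obtains T :: "'z \<times> real \<Rightarrow> 'a"
  where "T \<in> N \<Otimes>\<^sub>M borel \<rightarrow>\<^sub>M borel_of S"
    and "distr (distr \<mu> N l \<Otimes>\<^sub>M uniform_measure lborel {0..1}) (N \<Otimes>\<^sub>M borel_of S) (\<lambda>p. (fst p, T p))
      = distr \<mu> (N \<Otimes>\<^sub>M borel_of S) (\<lambda>x. (l x, x))"
proof -
  have p: "prob_space \<mu>" and s [measurable_cong]: "sets \<mu> = sets (borel_of S)"
    using \<mu> by (auto simp: prob_measures_def)
  have sp: "space \<mu> = topspace S"
    using sets_eq_imp_space_eq[OF s] by (simp add: space_borel_of)
  have "topspace S \<noteq> {}" using prob_space.not_empty[OF p] sp by simp
  then obtain \<phi> :: "'a \<Rightarrow> real" and g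
    where \<phi>: "\<phi> \<in> borel_measurable (borel_of S)" "\<And>x. 0 \<le> \<phi> x" "\<And>x. \<phi> x \<le> 1"
      and g: "g \<in> borel \<rightarrow>\<^sub>M borel_of S" and g\<phi>: "\<And>x. x \<in> topspace S \<Longrightarrow> g (\<phi> x) = x"
    using Polish_space_real_coding[OF S] by blast
  have l': "l \<in> \<mu> \<rightarrow>\<^sub>M N" and \<phi>': "\<phi> \<in> borel_measurable \<mu>"
    using l \<phi>(1) measurable_cong_sets[OF s refl] by blast+
  obtain T0 :: "'z \<times> real \<Rightarrow> real" where T0: "T0 \<in> borel_measurable (N \<Otimes>\<^sub>M borel)"
    and eq: "distr (distr \<mu> N l \<Otimes>\<^sub>M uniform_measure lborel {0..1}) (N \<Otimes>\<^sub>M borel) (\<lambda>p. (fst p, T0 p))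
      = distr \<mu> (N \<Otimes>\<^sub>M borel) (\<lambda>x. (l x, \<phi> x))"
    by (rule noise_outsourcing_real[OF p l' \<phi>' \<phi>(2,3)]) (rule that)
  define W where "W = distr \<mu> N l \<Otimes>\<^sub>M uniform_measure lborel {0..1::real}"
  have W_sets [measurable_cong]: "sets W = sets (N \<Otimes>\<^sub>M borel)"
    unfolding W_def by (rule sets_pair_measure_cong) simp_all
  note [measurable] = T0 g l' \<phi>'
  have G: "(\<lambda>p. (fst p, g (snd p))) \<in> N \<Otimes>\<^sub>M borel \<rightarrow>\<^sub>M N \<Otimes>\<^sub>M borel_of S" by measurable
  have m0: "(\<lambda>p. (fst p, T0 p)) \<in> W \<rightarrow>\<^sub>M N \<Otimes>\<^sub>M borel" by measurable
  have ml: "(\<lambda>x. (l x, \<phi> x)) \<in> \<mu> \<rightarrow>\<^sub>M N \<Otimes>\<^sub>M borel" by (intro measurable_Pair l' \<phi>')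
  have "distr W (N \<Otimes>\<^sub>M borel_of S) (\<lambda>p. (fst p, g (T0 p)))
      = distr (distr W (N \<Otimes>\<^sub>M borel) (\<lambda>p. (fst p, T0 p))) (N \<Otimes>\<^sub>M borel_of S) (\<lambda>p. (fst p, g (snd p)))"
    by (simp add: distr_distr[OF G m0] comp_def)
  also have "\<dots> = distr (distr \<mu> (N \<Otimes>\<^sub>M borel) (\<lambda>x. (l x, \<phi> x))) (N \<Otimes>\<^sub>M borel_of S) (\<lambda>p. (fst p, g (snd p)))"
    using eq by (simp add: W_def)
  also have "\<dots> = distr \<mu> (N \<Otimes>\<^sub>M borel_of S) (\<lambda>x. (l x, g (\<phi> x)))"
    by (simp add: distr_distr[OF G ml] comp_def)
  also have "\<dots> = distr \<mu> (N \<Otimes>\<^sub>M borel_of S) (\<lambda>x. (l x, x))"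
    by (rule distr_cong) (simp_all add: sp g\<phi>)
  finally show ?thesis
    using that[of "\<lambda>p. g (T0 p)"] measurable_compose[OF T0 g] by (simp add: W_def)
qed

text \<open>Both claims are read off from the joint law of \<open>(z, T (z, u))\<close>, which
  equals that of \<open>(l x, x)\<close>: its second marginal is \<mu>, and it is concentrated on
  the measurable set of pairs whose first entry is \<open>l\<close> of the second.\<close>

lemma randomized_section:
  fixes S :: "'a topology" and Z :: "'z topology" and l :: "'a \<Rightarrow> 'z"
  assumes S: "Polish_space S" and Z: "Polish_space Z" and \<mu>: "\<mu> \<in> prob_measures S"
    and l: "l \<in> borel_of S \<rightarrow>\<^sub>M borel_of Z"
  obtains T :: "'z \<times> real \<Rightarrow> 'a"
  where "T \<in> borel_of Z \<Otimes>\<^sub>M borel \<rightarrow>\<^sub>M borel_of S"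
    and "distr (distr \<mu> (borel_of Z) l \<Otimes>\<^sub>M uniform_measure lborel {0..1}) (borel_of S) T = \<mu>"
    and "AE p in distr \<mu> (borel_of Z) l \<Otimes>\<^sub>M uniform_measure lborel {0..1}. l (T p) = fst p"
proof -
  have s [measurable_cong]: "sets \<mu> = sets (borel_of S)"
    using \<mu> by (auto simp: prob_measures_def)
  define W where "W = distr \<mu> (borel_of Z) l \<Otimes>\<^sub>M uniform_measure lborel {0..1::real}"
  have W_sets [measurable_cong]: "sets W = sets (borel_of Z \<Otimes>\<^sub>M borel)"
    unfolding W_def by (rule sets_pair_measure_cong) simp_all
  obtain T where T [measurable]: "T \<in> borel_of Z \<Otimes>\<^sub>M borel \<rightarrow>\<^sub>M borel_of S"
    and eq: "distr W (borel_of Z \<Otimes>\<^sub>M borel_of S) (\<lambda>p. (fst p, T p))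
      = distr \<mu> (borel_of Z \<Otimes>\<^sub>M borel_of S) (\<lambda>x. (l x, x))"
    by (rule noise_outsourcing[OF S \<mu> l, folded W_def]) (rule that)
  have l' [measurable]: "l \<in> \<mu> \<rightarrow>\<^sub>M borel_of Z"
    using l measurable_cong_sets[OF s refl] by blast
  have T' [measurable]: "T \<in> W \<rightarrow>\<^sub>M borel_of S"
    using T measurable_cong_sets[OF W_sets refl] by blast
  have ml: "(\<lambda>x. (l x, x)) \<in> \<mu> \<rightarrow>\<^sub>M borel_of Z \<Otimes>\<^sub>M borel_of S"
    by (intro measurable_Pair l' measurable_ident_sets s)
  have mT: "(\<lambda>p. (fst p, T p)) \<in> W \<rightarrow>\<^sub>M borel_of Z \<Otimes>\<^sub>M borel_of S" by measurable
  have "distr W (borel_of S) T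
      = distr (distr W (borel_of Z \<Otimes>\<^sub>M borel_of S) (\<lambda>p. (fst p, T p))) (borel_of S) snd"
    by (simp add: distr_distr[OF measurable_snd mT] comp_def)
  also have "\<dots> = distr \<mu> (borel_of S) (\<lambda>x. x)"
    by (simp add: eq distr_distr[OF measurable_snd ml] comp_def)
  also have "\<dots> = \<mu>" by (rule distr_id2[OF s[symmetric]])
  finally have 1: "distr W (borel_of S) T = \<mu>" .
  have graph: "{p \<in> space (borel_of Z \<Otimes>\<^sub>M borel_of S). l (snd p) = fst p} \<in> sets (borel_of Z \<Otimes>\<^sub>M borel_of S)"
  proof -
    have "{p \<in> space (borel_of Z \<Otimes>\<^sub>M borel_of S). l (snd p) = fst p}
        = {(z, x) \<in> space (borel_of Z \<Otimes>\<^sub>M borel_of S). z = l x}" by auto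
    then show ?thesis
      using graph_measurable_borel_of[OF Polish_space_imp_Hausdorff_space[OF Z]
          Polish_space_imp_second_countable[OF Z] l] by simp
  qed
  have "AE p in distr \<mu> (borel_of Z \<Otimes>\<^sub>M borel_of S) (\<lambda>x. (l x, x)). l (snd p) = fst p"
    by (subst AE_distr_iff[OF ml graph]) simp
  then have "AE p in W. l (T p) = fst p"
    unfolding eq[symmetric] by (subst (asm) AE_distr_iff[OF mT graph]) simp
  then show ?thesis using 1 unfolding W_def by (intro that[OF T])
qed

section \<open>Transport problems with free marginals\<close>

declare One_nat_def [simp del]

section \<open>Marginals, images and lifts of plans\<close>

lemma measurable_fst_component:
  assumes "i \<in> I"
  shows "(\<lambda>p. fst p i) \<in> borel_of (prod_topology (product_topology X I) S) \<rightarrow>\<^sub>M borel_of (X i)"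
  by (rule continuous_map_measurable_borel_of)
    (use continuous_map_compose[OF continuous_map_fst continuous_map_product_projection[OF assms]]
      in \<open>simp add: comp_def\<close>)

lemma distr_fst_component:
  assumes s: "sets \<gamma> = sets (borel_of (prod_topology (product_topology X I) S))" and i: "i \<in> I"
  shows "distr (distr \<gamma> (borel_of (product_topology X I)) fst) (borel_of (X i)) (\<lambda>x. x i)
    = distr \<gamma> (borel_of (X i)) (\<lambda>p. fst p i)"
proof -
  have "fst \<in> \<gamma> \<rightarrow>\<^sub>M borel_of (product_topology X I)"
    using continuous_map_measurable_borel_of[OF continuous_map_fst] measurable_cong_sets[OF s refl] by blast
  moreover have "(\<lambda>x. x i) \<in> borel_of (product_topology X I) \<rightarrow>\<^sub>M borel_of (X i)"
    by (rule continuous_map_measurable_borel_of[OF continuous_map_product_projection[OF i]])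
  ultimately show ?thesis by (simp add: distr_distr comp_def)
qed

text \<open>The projected law is automatically a probability measure on the product, and its
  marginals are those of the plan itself, so the two-stage constraint reduces to one condition per
  coordinate.\<close>

lemma free_couplings_iff:
  "\<gamma> \<in> free_couplings X k Y h \<mu> \<longleftrightarrow>
    \<gamma> \<in> prob_measures (prod_topology (prod_space X k) (prod_space Y h)) \<and>
    (\<forall>i\<in>{1..k}. distr \<gamma> (borel_of (X i)) (\<lambda>p. fst p i) = \<mu> i)"
proof (cases "\<gamma> \<in> prob_measures (prod_topology (prod_space X k) (prod_space Y h))")
  case True
  then have s: "sets \<gamma> = sets (borel_of (prod_topology (prod_space X k) (prod_space Y h)))"
    and p: "prob_space \<gamma>" by (auto simp: prob_measures_def)
  have "fst \<in> \<gamma> \<rightarrow>\<^sub>M borel_of (prod_space X k)"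
    using continuous_map_measurable_borel_of[OF continuous_map_fst] measurable_cong_sets[OF s refl] by blast
  then have "distr \<gamma> (borel_of (prod_space X k)) fst \<in> prob_measures (prod_space X k)"
    using prob_space.prob_space_distr[OF p] by (simp add: prob_measures_def)
  with True show ?thesis
    by (simp add: free_couplings_def couplings_def distr_fst_component[OF s])
qed (simp add: free_couplings_def)

lemma measurable_map_prod_map_tuple:
  assumes "\<And>i. i \<in> {1..k} \<Longrightarrow> second_countable (Z i)" and "\<And>j. j \<in> {1..h} \<Longrightarrow> second_countable (Y j)"
    and l: "\<And>i. i \<in> {1..k} \<Longrightarrow> l i \<in> borel_of (X i) \<rightarrow>\<^sub>M borel_of (Z i)"
  shows "map_prod (map_tuple k l) id \<in> borel_of (prod_topology (prod_space X k) (prod_space Y h))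
    \<rightarrow>\<^sub>M borel_of (prod_topology (prod_space Z k) (prod_space Y h))"
proof -
  have "(\<lambda>p. (\<lambda>i\<in>{1..k}. l i (fst p i), snd p))
      \<in> borel_of (prod_topology (prod_space X k) (prod_space Y h))
        \<rightarrow>\<^sub>M borel_of (prod_topology (prod_space Z k) (prod_space Y h))"
  proof (rule measurable_borel_of_Pair)
    show "(\<lambda>p. \<lambda>i\<in>{1..k}. l i (fst p i)) \<in> borel_of (prod_topology (prod_space X k) (prod_space Y h))
        \<rightarrow>\<^sub>M borel_of (prod_space Z k)"
    proof (rule measurable_borel_of_product)
      fix i assume i: "i \<in> {1..k}"
      show "second_countable (Z i)" by (rule assms(1)[OF i])
      show "(\<lambda>p. l i (fst p i)) \<in> borel_of (prod_topology (prod_space X k) (prod_space Y h)) \<rightarrow>\<^sub>M borel_of (Z i)"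
        by (rule measurable_compose[OF measurable_fst_component[where X = X, OF i] l[OF i]])
    qed simp
    show "snd \<in> borel_of (prod_topology (prod_space X k) (prod_space Y h)) \<rightarrow>\<^sub>M borel_of (prod_space Y h)"
      by (rule continuous_map_measurable_borel_of[OF continuous_map_snd])
  qed (auto intro!: second_countable_product_topology assms)
  then show ?thesis by (simp add: map_prod_def map_tuple_def case_prod_beta')
qed

text \<open>Coordinate \<open>i\<close> of the image point is \<open>l i\<close> applied to
  coordinate \<open>i\<close>, so taking marginals commutes with taking images.\<close>

lemma free_couplings_push:
  assumes Z: "\<And>i. i \<in> {1..k} \<Longrightarrow> second_countable (Z i)" and Y: "\<And>j. j \<in> {1..h} \<Longrightarrow> second_countable (Y j)"
    and l: "\<And>i. i \<in> {1..k} \<Longrightarrow> l i \<in> borel_of (X i) \<rightarrow>\<^sub>M borel_of (Z i)"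
    and \<gamma>: "\<gamma> \<in> free_couplings X k Y h \<mu>"
  shows "distr \<gamma> (borel_of (prod_topology (prod_space Z k) (prod_space Y h))) (map_prod (map_tuple k l) id)
    \<in> free_couplings Z k Y h (push_tuple Z l \<mu>)"
proof -
  let ?ZY = "borel_of (prod_topology (prod_space Z k) (prod_space Y h))"
  let ?L = "map_prod (map_tuple k l) id :: _ \<Rightarrow> _ \<times> (nat \<Rightarrow> 'd)"
  have s: "sets \<gamma> = sets (borel_of (prod_topology (prod_space X k) (prod_space Y h)))"
    and p: "prob_space \<gamma>" and m: "\<And>i. i \<in> {1..k} \<Longrightarrow> distr \<gamma> (borel_of (X i)) (\<lambda>p. fst p i) = \<mu> i"
    using \<gamma> by (auto simp: free_couplings_iff prob_measures_def)
  have "?L \<in> borel_of (prod_topology (prod_space X k) (prod_space Y h)) \<rightarrow>\<^sub>M ?ZY"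
    by (rule measurable_map_prod_map_tuple) (fact Z Y l)+
  then have L: "?L \<in> \<gamma> \<rightarrow>\<^sub>M ?ZY"
    using measurable_cong_sets[OF s refl] by blast
  have "distr (distr \<gamma> ?ZY ?L) (borel_of (Z i)) (\<lambda>p. fst p i) = push_tuple Z l \<mu> i" if i: "i \<in> {1..k}" for i
  proof -
    have f: "(\<lambda>p. fst p i) \<in> \<gamma> \<rightarrow>\<^sub>M borel_of (X i)"
      using measurable_fst_component[OF i] measurable_cong_sets[OF s refl] by blast
    have "distr (distr \<gamma> ?ZY ?L) (borel_of (Z i)) (\<lambda>p. fst p i) = distr \<gamma> (borel_of (Z i)) (\<lambda>p. l i (fst p i))"
      using i by (simp add: distr_distr[OF measurable_fst_component[OF i] L] comp_def map_tuple_def)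
    also have "\<dots> = distr (distr \<gamma> (borel_of (X i)) (\<lambda>p. fst p i)) (borel_of (Z i)) (l i)"
      by (simp add: distr_distr[OF l[OF i] f] comp_def)
    finally show ?thesis by (simp add: m[OF i] push_tuple_def)
  qed
  then show ?thesis
    using prob_space.prob_space_distr[OF p L] by (simp add: free_couplings_iff prob_measures_def)
qed

text \<open>Each coordinate \<open>z i\<close> is replaced by \<open>T i (z i, u)\<close> with a
  common seed, while \<open>y\<close> is carried along unchanged. Applying \<open>l\<close> recovers
  \<open>z\<close> almost surely, so the whole joint law of \<open>(z, y)\<close> is restored, and
  the new coordinates have laws \<open>\<mu> i\<close>.\<close>

lemma free_couplings_lift:
  fixes X :: "nat \<Rightarrow> 'a topology" and Y :: "nat \<Rightarrow> 'b topology" and Z :: "nat \<Rightarrow> 'c topology"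
  assumes X: "\<And>i. i \<in> {1..k} \<Longrightarrow> Polish_space (X i)" and Y: "\<And>j. j \<in> {1..h} \<Longrightarrow> second_countable (Y j)"
    and Z: "\<And>i. i \<in> {1..k} \<Longrightarrow> Polish_space (Z i)"
    and l: "\<And>i. i \<in> {1..k} \<Longrightarrow> l i \<in> borel_of (X i) \<rightarrow>\<^sub>M borel_of (Z i)"
    and \<mu>: "\<And>i. i \<in> {1..k} \<Longrightarrow> \<mu> i \<in> prob_measures (X i)"
    and \<gamma>': "\<gamma>' \<in> free_couplings Z k Y h (push_tuple Z l \<mu>)"
  shows "\<exists>\<gamma>\<in>free_couplings X k Y h \<mu>.
    distr \<gamma> (borel_of (prod_topology (prod_space Z k) (prod_space Y h))) (map_prod (map_tuple k l) id) = \<gamma>'"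
proof -
  let ?XY = "borel_of (prod_topology (prod_space X k) (prod_space Y h))"
  let ?ZY = "borel_of (prod_topology (prod_space Z k) (prod_space Y h))"
  let ?L = "map_prod (map_tuple k l) id :: (nat \<Rightarrow> 'a) \<times> (nat \<Rightarrow> 'b) \<Rightarrow> (nat \<Rightarrow> 'c) \<times> (nat \<Rightarrow> 'b)"
  define U where "U = uniform_measure lborel {0..1::real}"
  interpret U: prob_space U unfolding U_def by (rule prob_space_uniform_measure) auto
  have U_sets [measurable_cong]: "sets U = sets borel" by (simp add: U_def)
  have s [measurable_cong]: "sets \<gamma>' = sets ?ZY" and p: "prob_space \<gamma>'"
    and m: "\<And>i. i \<in> {1..k} \<Longrightarrow> distr \<gamma>' (borel_of (Z i)) (\<lambda>p. fst p i) = distr (\<mu> i) (borel_of (Z i)) (l i)"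
    using \<gamma>' by (auto simp: free_couplings_iff prob_measures_def push_tuple_def)
  have sp: "space \<gamma>' = topspace (prod_space Z k) \<times> topspace (prod_space Y h)"
    using sets_eq_imp_space_eq[OF s] by (simp add: space_borel_of)
  define W where "W = \<gamma>' \<Otimes>\<^sub>M U"
  interpret \<gamma>': prob_space \<gamma>' by fact
  interpret W: pair_prob_space \<gamma>' U ..
  have pW: "prob_space W" unfolding W_def by (rule W.prob_space_axioms)
  have ex: "\<forall>i\<in>{1..k}. \<exists>T. T \<in> borel_of (Z i) \<Otimes>\<^sub>M borel \<rightarrow>\<^sub>M borel_of (X i) \<and>
      distr (distr (\<mu> i) (borel_of (Z i)) (l i) \<Otimes>\<^sub>M U) (borel_of (X i)) T = \<mu> i \<and>
      (AE q in distr (\<mu> i) (borel_of (Z i)) (l i) \<Otimes>\<^sub>M U. l i (T q) = fst q)"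
  proof
    fix i assume i: "i \<in> {1..k}"
    obtain T where "T \<in> borel_of (Z i) \<Otimes>\<^sub>M borel \<rightarrow>\<^sub>M borel_of (X i)"
      "distr (distr (\<mu> i) (borel_of (Z i)) (l i) \<Otimes>\<^sub>M U) (borel_of (X i)) T = \<mu> i"
      "AE q in distr (\<mu> i) (borel_of (Z i)) (l i) \<Otimes>\<^sub>M U. l i (T q) = fst q"
      by (rule randomized_section[OF X[OF i] Z[OF i] \<mu>[OF i] l[OF i], folded U_def]) (rule that)
    then show "\<exists>T. T \<in> borel_of (Z i) \<Otimes>\<^sub>M borel \<rightarrow>\<^sub>M borel_of (X i) \<and>
        distr (distr (\<mu> i) (borel_of (Z i)) (l i) \<Otimes>\<^sub>M U) (borel_of (X i)) T = \<mu> i \<and>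
        (AE q in distr (\<mu> i) (borel_of (Z i)) (l i) \<Otimes>\<^sub>M U. l i (T q) = fst q)"
      by (intro exI[of _ T] conjI)
  qed
  from bchoice[OF ex] obtain T where T_all: "\<forall>i\<in>{1..k}. T i \<in> borel_of (Z i) \<Otimes>\<^sub>M borel \<rightarrow>\<^sub>M borel_of (X i) \<and>
      distr (distr (\<mu> i) (borel_of (Z i)) (l i) \<Otimes>\<^sub>M U) (borel_of (X i)) (T i) = \<mu> i \<and>
      (AE q in distr (\<mu> i) (borel_of (Z i)) (l i) \<Otimes>\<^sub>M U. l i (T i q) = fst q)" ..
  have T: "T i \<in> borel_of (Z i) \<Otimes>\<^sub>M borel \<rightarrow>\<^sub>M borel_of (X i)"
    and T_distr: "distr (distr (\<mu> i) (borel_of (Z i)) (l i) \<Otimes>\<^sub>M U) (borel_of (X i)) (T i) = \<mu> i"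
    and T_AE: "AE q in distr (\<mu> i) (borel_of (Z i)) (l i) \<Otimes>\<^sub>M U. l i (T i q) = fst q"
    if "i \<in> {1..k}" for i
    using bspec[OF T_all that] by simp_all
  have comp: "(\<lambda>p. fst p i) \<in> \<gamma>' \<rightarrow>\<^sub>M borel_of (Z i)" if "i \<in> {1..k}" for i
    using measurable_fst_component[OF that] measurable_cong_sets[OF s refl] by blast
  have pr: "(\<lambda>w. (fst (fst w) i, snd w)) \<in> W \<rightarrow>\<^sub>M borel_of (Z i) \<Otimes>\<^sub>M U" if "i \<in> {1..k}" for i
    using comp[OF that] unfolding W_def by measurable
  \<comment> \<open>The seed is independent of the plan, so coordinate \<open>i\<close> together
    with the seed has exactly the product law for which \<open>T i\<close> was built, whatever the
    dependence between the coordinates.\<close>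
  have pr_distr: "distr W (borel_of (Z i) \<Otimes>\<^sub>M U) (\<lambda>w. (fst (fst w) i, snd w))
      = distr (\<mu> i) (borel_of (Z i)) (l i) \<Otimes>\<^sub>M U" if i: "i \<in> {1..k}" for i
    using pair_measure_distr[OF comp[OF i], of "\<lambda>u. u" U U] U.sigma_finite_measure_axioms
    by (simp add: W_def m[OF i] case_prod_beta')
  have T': "T i \<in> borel_of (Z i) \<Otimes>\<^sub>M U \<rightarrow>\<^sub>M borel_of (X i)" if "i \<in> {1..k}" for i
    using T[OF that] by measurable
  have Tpr: "(\<lambda>w. T i (fst (fst w) i, snd w)) \<in> W \<rightarrow>\<^sub>M borel_of (X i)" if "i \<in> {1..k}" for i
    using measurable_compose[OF pr[OF that] T'[OF that]] .
  define \<Phi> where "\<Phi> w = (\<lambda>i\<in>{1..k}. T i (fst (fst w) i, snd w), snd (fst w))"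
    for w :: "((nat \<Rightarrow> 'c) \<times> (nat \<Rightarrow> 'b)) \<times> real"
  have \<Phi>: "\<Phi> \<in> W \<rightarrow>\<^sub>M ?XY"
    unfolding \<Phi>_def
  proof (rule measurable_borel_of_Pair)
    show "(\<lambda>w. \<lambda>i\<in>{1..k}. T i (fst (fst w) i, snd w)) \<in> W \<rightarrow>\<^sub>M borel_of (prod_space X k)"
      by (rule measurable_borel_of_product) (simp, fact Polish_space_imp_second_countable[OF X], fact Tpr)
    have "snd \<in> \<gamma>' \<rightarrow>\<^sub>M borel_of (prod_space Y h)"
      using continuous_map_measurable_borel_of[OF continuous_map_snd] measurable_cong_sets[OF s refl] by blast
    then show "(\<lambda>w. snd (fst w)) \<in> W \<rightarrow>\<^sub>M borel_of (prod_space Y h)"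
      unfolding W_def by (rule measurable_compose[OF measurable_fst])
  qed (auto intro!: second_countable_product_topology Polish_space_imp_second_countable[OF X] Y)
  have L: "?L \<in> ?XY \<rightarrow>\<^sub>M ?ZY"
    by (rule measurable_map_prod_map_tuple) (fact Y l Polish_space_imp_second_countable[OF Z])+
  have "distr (distr W ?XY \<Phi>) (borel_of (X i)) (\<lambda>p. fst p i) = \<mu> i" if i: "i \<in> {1..k}" for i
  proof -
    have "distr (distr W ?XY \<Phi>) (borel_of (X i)) (\<lambda>p. fst p i)
        = distr W (borel_of (X i)) (\<lambda>w. T i (fst (fst w) i, snd w))"
      using i by (simp add: distr_distr[OF measurable_fst_component[OF i] \<Phi>] comp_def \<Phi>_def)
    also have "\<dots> = distr (distr W (borel_of (Z i) \<Otimes>\<^sub>M U) (\<lambda>w. (fst (fst w) i, snd w))) (borel_of (X i)) (T i)"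
      by (simp add: distr_distr[OF T'[OF i] pr[OF i]] comp_def)
    finally show ?thesis by (simp add: pr_distr[OF i] T_distr[OF i])
  qed
  then have "distr W ?XY \<Phi> \<in> free_couplings X k Y h \<mu>"
    using prob_space.prob_space_distr[OF pW \<Phi>] by (simp add: free_couplings_iff prob_measures_def)
  moreover have "distr (distr W ?XY \<Phi>) ?ZY ?L = \<gamma>'"
  proof -
    have "AE w in W. l i (T i (fst (fst w) i, snd w)) = fst (fst w) i" if i: "i \<in> {1..k}" for i
      using AE_distrD[OF pr[OF i], unfolded pr_distr[OF i], OF T_AE[OF i]] by simp
    then have "AE w in W. \<forall>i\<in>{1..k}. l i (T i (fst (fst w) i, snd w)) = fst (fst w) i"
      by (intro AE_finite_allI) auto
    then have "AE w in W. (?L \<circ> \<Phi>) w = fst w"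
    proof (rule AE_mp, intro AE_I2 impI)
      fix w assume w: "w \<in> space W"
        and eq: "\<forall>i\<in>{1..k}. l i (T i (fst (fst w) i, snd w)) = fst (fst w) i"
      \<comment> \<open>Points of the product are \<open>undefined\<close> outside
        \<open>{1..k}\<close>, as are values of \<open>map_tuple\<close>; hence agreement on
        \<open>{1..k}\<close> is equality of functions.\<close>
      have "fst (fst w) \<in> extensional {1..k}"
        using w by (auto simp: W_def space_pair_measure sp PiE_def)
      then have "map_tuple k l (fst (\<Phi> w)) = fst (fst w)"
        using eq by (auto simp: map_tuple_def \<Phi>_def extensional_def fun_eq_iff)
      then show "(?L \<circ> \<Phi>) w = fst w"
        by (simp add: prod_eq_iff \<Phi>_def)
    qed
    moreover have "fst \<in> W \<rightarrow>\<^sub>M \<gamma>'"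
      unfolding W_def by (rule measurable_fst)
    \<comment> \<open>Almost surely equal maps have the same law, and the first marginal of
      \<gamma>' with an independent seed is \<gamma>' again.\<close>
    ultimately have "distr W ?ZY (?L \<circ> \<Phi>) = distr W \<gamma>' fst"
      by (intro distr_cong_AE[OF refl s[symmetric] _ measurable_comp[OF \<Phi> L]])
    then show ?thesis
      unfolding distr_distr[OF L \<Phi>] by (simp add: W_def U.distr_pair_fst)
  qed
  ultimately show ?thesis by blast
qed

theorem lemma6p1:
  fixes k h :: nat
    and X :: "nat \<Rightarrow> 'a topology" and Y :: "nat \<Rightarrow> 'b topology" and Z :: "nat \<Rightarrow> 'c topology"
    and c :: "(nat \<Rightarrow> 'c) \<times> (nat \<Rightarrow> 'b) \<Rightarrow> ennreal"
    and l :: "nat \<Rightarrow> 'a \<Rightarrow> 'c"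
    and \<mu> :: "nat \<Rightarrow> 'a measure"
  assumes "k \<ge> 1"
    and "\<And>i. i \<in> {1..k} \<Longrightarrow> Polish_space (X i)"
    and "\<And>j. j \<in> {1..h} \<Longrightarrow> Polish_space (Y j)"
    and "\<And>i. i \<in> {1..k} \<Longrightarrow> Polish_space (Z i)"
    and "c \<in> borel_measurable (borel_of (prod_topology (prod_space Z k) (prod_space Y h)))"
    and "\<And>i. i \<in> {1..k} \<Longrightarrow> l i \<in> borel_of (X i) \<rightarrow>\<^sub>M borel_of (Z i)"
    and "\<And>i. i \<in> {1..k} \<Longrightarrow> \<mu> i \<in> prob_measures (X i)"
  shows "OT_free X k Y h (c \<circ> map_prod (map_tuple k l) id) \<mu>
           = (INF \<gamma>\<in>{\<gamma> \<in> prob_measures (prod_topology (prod_space X k) (prod_space Y h)).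
                distr \<gamma> (borel_of (prod_space X k)) fst \<in> couplings X k \<mu>}.
                \<integral>\<^sup>+ p. (c \<circ> map_prod (map_tuple k l) id) p \<partial>\<gamma>)
         \<and> (INF \<gamma>\<in>{\<gamma> \<in> prob_measures (prod_topology (prod_space X k) (prod_space Y h)).
                distr \<gamma> (borel_of (prod_space X k)) fst \<in> couplings X k \<mu>}.
                \<integral>\<^sup>+ p. (c \<circ> map_prod (map_tuple k l) id) p \<partial>\<gamma>)
           = (INF \<gamma>'\<in>{\<gamma>' \<in> prob_measures (prod_topology (prod_space Z k) (prod_space Y h)).
                distr \<gamma>' (borel_of (prod_space Z k)) fst \<in> couplings Z k (push_tuple Z l \<mu>)}.
                \<integral>\<^sup>+ p. c p \<partial>\<gamma>')
         \<and> (INF \<gamma>'\<in>{\<gamma>' \<in> prob_measures (prod_topology (prod_space Z k) (prod_space Y h)).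
                distr \<gamma>' (borel_of (prod_space Z k)) fst \<in> couplings Z k (push_tuple Z l \<mu>)}.
                \<integral>\<^sup>+ p. c p \<partial>\<gamma>')
           = OT_free Z k Y h c (push_tuple Z l \<mu>)"
proof -
  let ?L = "map_prod (map_tuple k l) id :: (nat \<Rightarrow> 'a) \<times> (nat \<Rightarrow> 'b) \<Rightarrow> (nat \<Rightarrow> 'c) \<times> (nat \<Rightarrow> 'b)"
  let ?push = "\<lambda>\<gamma>. distr \<gamma> (borel_of (prod_topology (prod_space Z k) (prod_space Y h))) ?L"
  have Y: "\<And>j. j \<in> {1..h} \<Longrightarrow> second_countable (Y j)" and Z: "\<And>i. i \<in> {1..k} \<Longrightarrow> second_countable (Z i)"
    using assms(3,4) by (simp_all add: Polish_space_imp_second_countable)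
  have int: "(\<integral>\<^sup>+ p. c p \<partial>?push \<gamma>) = (\<integral>\<^sup>+ p. (c \<circ> ?L) p \<partial>\<gamma>)" if "\<gamma> \<in> free_couplings X k Y h \<mu>" for \<gamma>
  proof -
    have s: "sets \<gamma> = sets (borel_of (prod_topology (prod_space X k) (prod_space Y h)))"
      using that by (auto simp: free_couplings_iff prob_measures_def)
    have "?L \<in> borel_of (prod_topology (prod_space X k) (prod_space Y h))
        \<rightarrow>\<^sub>M borel_of (prod_topology (prod_space Z k) (prod_space Y h))"
      by (rule measurable_map_prod_map_tuple) (fact Z Y assms(6))+
    then have "?L \<in> \<gamma> \<rightarrow>\<^sub>M borel_of (prod_topology (prod_space Z k) (prod_space Y h))"
      using measurable_cong_sets[OF s refl] by blast
    then show ?thesis using assms(5) by (simp add: nn_integral_distr)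
  qed
  \<comment> \<open>More than equality of infima: every plan on either side is matched by one of
    exactly the same cost on the other, so the sets of attainable costs coincide and no minimizers
    or approximations enter.\<close>
  have "(\<lambda>\<gamma>. \<integral>\<^sup>+ p. (c \<circ> ?L) p \<partial>\<gamma>) ` free_couplings X k Y h \<mu>
      = (\<lambda>\<gamma>'. \<integral>\<^sup>+ p. c p \<partial>\<gamma>') ` free_couplings Z k Y h (push_tuple Z l \<mu>)"
  proof (intro equalityI image_subsetI)
    fix \<gamma> assume \<gamma>: "\<gamma> \<in> free_couplings X k Y h \<mu>"
    show "(\<integral>\<^sup>+ p. (c \<circ> ?L) p \<partial>\<gamma>)
        \<in> (\<lambda>\<gamma>'. \<integral>\<^sup>+ p. c p \<partial>\<gamma>') ` free_couplings Z k Y h (push_tuple Z l \<mu>)"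
    proof (rule image_eqI[where x = "?push \<gamma>"])
      show "(\<integral>\<^sup>+ p. (c \<circ> ?L) p \<partial>\<gamma>) = (\<integral>\<^sup>+ p. c p \<partial>?push \<gamma>)" by (rule int[OF \<gamma>, symmetric])
      show "?push \<gamma> \<in> free_couplings Z k Y h (push_tuple Z l \<mu>)"
        by (rule free_couplings_push) (fact Z Y assms(6) \<gamma>)+
    qed
  next
    fix \<gamma>' assume \<gamma>': "\<gamma>' \<in> free_couplings Z k Y h (push_tuple Z l \<mu>)"
    have "\<exists>\<gamma>\<in>free_couplings X k Y h \<mu>. ?push \<gamma> = \<gamma>'"
      by (rule free_couplings_lift) (fact assms(2) Y assms(4,6,7) \<gamma>')+
    then obtain \<gamma> where "\<gamma> \<in> free_couplings X k Y h \<mu>" "?push \<gamma> = \<gamma>'" ..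
    then show "(\<integral>\<^sup>+ p. c p \<partial>\<gamma>') \<in> (\<lambda>\<gamma>. \<integral>\<^sup>+ p. (c \<circ> ?L) p \<partial>\<gamma>) ` free_couplings X k Y h \<mu>"
      using int by (intro image_eqI[of _ _ \<gamma>]) auto
  qed
  then show ?thesis
    unfolding OT_free_def free_couplings_def[symmetric] by (intro conjI refl arg_cong[where f = Inf])
qed

end
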